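(* Let $n\ge 1$ and let $f:SO(n)\to\mathbb{R}$, $f(\Theta)=n-\operatorname{tr}(\Theta)$. Equip $SO(n)$ with the Riemannian metric $g(\Omega_1\Theta,\Omega_2\Theta)=\operatorname{tr}(\Omega_1^{\mathsf T}\Omega_2)$, and consider the gradient flow $\dot\Theta=-\operatorname{grad} f(\Theta)$ on $SO(n)$. Then: 1. The $\omega$-limit set of any solution is contained in the set of equilibria $\mathcal{F}=\{\Theta_0\in SO(n)\mid \Theta_0^{\mathsf T}=\Theta_0\}$. 2. The equilibrium $I$ (the identity matrix) is locally exponentially stable, and all other equilibria are unstable. 3. The set of initial conditions for which the solutions of the gradient flow converge to $I$ is dense in $SO(n)$, and the set of initial conditions for which the solutions of the gradient flow converge to the other equilibria (those different from $I$) has measure zero in $SO(n)$.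
   Context: $SO(n)=\{\Theta\in\mathbb{R}^{n\times n}\mid \Theta^{-1}=\Theta^{\mathsf T},\ \det\Theta=1\}$, a smooth submanifold of $\mathbb{R}^{n\times n}$ with the subspace topology, with tangent spaces $T_\Theta SO(n)=\{\Omega\Theta\mid \Omega\in\mathbb{R}^{n\times n},\ \Omega=-\Omega^{\mathsf T}\}$. The metric $g$ is the one induced by the Euclidean inner product $\operatorname{tr}(X^{\mathsf T}Y)$ on $\mathbb{R}^{n\times n}$. The gradient of $f$ is the unique vector field with $df_\Theta(\Omega\Theta)=g(\operatorname{grad} f(\Theta),\Omega\Theta)$ for all skew-symmetric $\Omega$. A subset $A$ of a smooth $m$-dimensional manifold $\mathcal{M}$ has measure zero if there is a collection of smooth charts $(U_l,\phi_l)$ whose domains cover $A$ and such that each $\phi_l(A\cap U_l)$ has Lebesgue measure zero in $\mathbb{R}^m$. Stability and instability of equilibria are meant in the sense of Lyapunov. *)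

theory Defs
  imports "HOL-Analysis.Analysis"
begin

section \<open>The special orthogonal group as a Riemannian submanifold of the matrix space\<close>

definition SO :: "(real^'n^'n) set" where
  "SO = {\<Theta>. rotation_matrix \<Theta>}"

definition skew_symmetric :: "real^'n^'n \<Rightarrow> bool" where
  "skew_symmetric \<Omega> \<longleftrightarrow> \<Omega> = - transpose \<Omega>"

definition SO_tangent_space :: "real^'n^'n \<Rightarrow> (real^'n^'n) set" where
  "SO_tangent_space \<Theta> = {\<Omega> ** \<Theta> | \<Omega>. skew_symmetric \<Omega>}"

definition SO_metric :: "real^'n^'n \<Rightarrow> real^'n^'n \<Rightarrow> real" where
  "SO_metric X Y = trace (transpose X ** Y)"

lemma SO_metric_right_translate:
  fixes \<Theta> :: "real^'n^'n"
  assumes "\<Theta> \<in> SO"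
  shows "SO_metric (\<Omega>1 ** \<Theta>) (\<Omega>2 ** \<Theta>) = trace (transpose \<Omega>1 ** \<Omega>2)"
proof -
  have orth: "\<Theta> ** transpose \<Theta> = mat 1"
    using assms by (simp add: SO_def rotation_matrix_def orthogonal_matrix_def)
  have "SO_metric (\<Omega>1 ** \<Theta>) (\<Omega>2 ** \<Theta>)
      = trace (transpose \<Theta> ** (transpose \<Omega>1 ** \<Omega>2 ** \<Theta>))"
    by (simp add: SO_metric_def matrix_transpose_mul matrix_mul_assoc)
  also have "\<dots> = trace (transpose \<Omega>1 ** \<Omega>2 ** \<Theta> ** transpose \<Theta>)"
    by (rule trace_mul_sym)
  also have "\<dots> = trace (transpose \<Omega>1 ** \<Omega>2 ** (\<Theta> ** transpose \<Theta>))"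
    by (simp add: matrix_mul_assoc)
  finally show ?thesis by (simp add: orth)
qed

lemma mem_SO_iff:
  fixes \<Theta> :: "real^'n^'n"
  shows "\<Theta> \<in> SO \<longleftrightarrow> invertible \<Theta> \<and> matrix_inv \<Theta> = transpose \<Theta> \<and> det \<Theta> = 1"
proof -
  have "invertible \<Theta> \<and> matrix_inv \<Theta> = transpose \<Theta> \<longleftrightarrow> orthogonal_matrix \<Theta>"
  proof -
    have inv: "\<Theta> ** matrix_inv \<Theta> = mat 1 \<and> matrix_inv \<Theta> ** \<Theta> = mat 1" if "invertible \<Theta>"
      using that unfolding invertible_def matrix_inv_def by (rule someI_ex)
    show ?thesis
    proof
      assume "invertible \<Theta> \<and> matrix_inv \<Theta> = transpose \<Theta>"
      then show "orthogonal_matrix \<Theta>"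
        using inv by (simp add: orthogonal_matrix_def)
    next
      assume orth: "orthogonal_matrix \<Theta>"
      then have invertible: "invertible \<Theta>"
        unfolding invertible_def orthogonal_matrix_def by blast
      moreover have "matrix_inv \<Theta> = transpose \<Theta>"
        by (metis orth inv[OF invertible] matrix_mul_assoc matrix_mul_lid matrix_mul_rid
            orthogonal_matrix_def)
      ultimately show "invertible \<Theta> \<and> matrix_inv \<Theta> = transpose \<Theta>" by blast
    qed
  qed
  then show ?thesis by (auto simp: SO_def rotation_matrix_def)
qed

text \<open>
  The derivative \<open>D\<close> below is taken within \<open>SO\<close>, so it depends only on the values of \<open>f\<close> there.
  As a linear map on the matrix space it is not unique, but its restriction to the tangent space,
  which is the differential of \<open>f\<close> at \<open>\<Theta>\<close>, is.
\<close>

definition is_SO_gradient :: "(real^'n^'n \<Rightarrow> real) \<Rightarrow> real^'n^'n \<Rightarrow> real^'n^'n \<Rightarrow> bool" where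
  "is_SO_gradient f \<Theta> V \<longleftrightarrow>
     V \<in> SO_tangent_space \<Theta> \<and>
     (\<exists>D. (f has_derivative D) (at \<Theta> within SO) \<and>
          (\<forall>\<Omega>. skew_symmetric \<Omega> \<longrightarrow> D (\<Omega> ** \<Theta>) = SO_metric V (\<Omega> ** \<Theta>)))"

definition SO_grad :: "(real^'n^'n \<Rightarrow> real) \<Rightarrow> real^'n^'n \<Rightarrow> real^'n^'n" where
  "SO_grad f \<Theta> = (THE V. is_SO_gradient f \<Theta> V)"


section \<open>Autonomous differential equations on a subset of a normed space\<close>

text \<open>Here \<open>M\<close> is the state space and \<open>X\<close> the vector field.\<close>

definition flow_solution ::
  "'a::real_normed_vector set \<Rightarrow> ('a \<Rightarrow> 'a) \<Rightarrow> (real \<Rightarrow> 'a) \<Rightarrow> bool" where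
  "flow_solution M X \<theta> \<longleftrightarrow>
     (\<forall>t\<ge>0. \<theta> t \<in> M \<and> (\<theta> has_vector_derivative X (\<theta> t)) (at t within {0..}))"

definition equilibria :: "'a::real_normed_vector set \<Rightarrow> ('a \<Rightarrow> 'a) \<Rightarrow> 'a set" where
  "equilibria M X = {p \<in> M. X p = 0}"

definition omega_limit_set :: "(real \<Rightarrow> 'a::topological_space) \<Rightarrow> 'a set" where
  "omega_limit_set \<theta> =
     {p. \<exists>s :: nat \<Rightarrow> real. filterlim s at_top sequentially \<and> (\<lambda>k. \<theta> (s k)) \<longlonglongrightarrow> p}"

definition lyapunov_stable ::
  "'a::real_normed_vector set \<Rightarrow> ('a \<Rightarrow> 'a) \<Rightarrow> 'a \<Rightarrow> bool" where
  "lyapunov_stable M X p \<longleftrightarrow>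
     (\<forall>\<epsilon>>0. \<exists>\<delta>>0. \<forall>\<theta>. flow_solution M X \<theta> \<and> dist (\<theta> 0) p < \<delta> \<longrightarrow>
        (\<forall>t\<ge>0. dist (\<theta> t) p < \<epsilon>))"

definition locally_exponentially_stable ::
  "'a::real_normed_vector set \<Rightarrow> ('a \<Rightarrow> 'a) \<Rightarrow> 'a \<Rightarrow> bool" where
  "locally_exponentially_stable M X p \<longleftrightarrow>
     (\<exists>\<delta>>0. \<exists>C>0. \<exists>\<alpha>>0. \<forall>\<theta>. flow_solution M X \<theta> \<and> dist (\<theta> 0) p < \<delta> \<longrightarrow>
        (\<forall>t\<ge>0. dist (\<theta> t) p \<le> C * exp (- \<alpha> * t) * dist (\<theta> 0) p))"

definition converging_initial_conditions ::
  "'a::real_normed_vector set \<Rightarrow> ('a \<Rightarrow> 'a) \<Rightarrow> 'a set \<Rightarrow> 'a set" where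
  "converging_initial_conditions M X P =
     {x \<in> M. \<exists>\<theta>. flow_solution M X \<theta> \<and> \<theta> 0 = x \<and> (\<exists>p\<in>P. (\<theta> \<longlongrightarrow> p) at_top)}"


section \<open>Smooth charts and sets of measure zero\<close>

text \<open>
  Since the dimension \<open>m\<close> of a chart is a number and not a type, \<open>\<real>\<^sup>m\<close> is
  the space of extensional functions on \<open>{..<m}\<close>, with topology \<open>powertop_real {..<m}\<close>
  and Lebesgue measure the completion of \<open>Pi\<^sub>M {..<m} (\<lambda>_. lborel)\<close>.
\<close>

text \<open>Functions of class \<open>C\<^sup>k\<close> on an open subset of a normed space and of \<open>\<real>\<^sup>m\<close>, respectively.\<close>

fun Ck_on :: "nat \<Rightarrow> 'a::euclidean_space set \<Rightarrow> ('a \<Rightarrow> 'b::real_normed_vector) \<Rightarrow> bool" where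
  "Ck_on 0 W h \<longleftrightarrow> continuous_on W h"
| "Ck_on (Suc k) W h \<longleftrightarrow>
     (\<forall>x\<in>W. h differentiable at x) \<and>
     (\<forall>v. Ck_on k W (\<lambda>x. frechet_derivative h (at x) v))"

fun Ck_coord :: "nat \<Rightarrow> nat \<Rightarrow> (nat \<Rightarrow> real) set \<Rightarrow>
    ((nat \<Rightarrow> real) \<Rightarrow> 'b::real_normed_vector) \<Rightarrow> bool" where
  "Ck_coord m 0 V h \<longleftrightarrow> continuous_map (subtopology (powertop_real {..<m}) V) euclidean h"
| "Ck_coord m (Suc k) V h \<longleftrightarrow>
     continuous_map (subtopology (powertop_real {..<m}) V) euclidean h \<and>
     (\<forall>i<m. (\<forall>x\<in>V. (\<lambda>t. h (x(i := t))) differentiable at (x i)) \<and>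
            Ck_coord m k V (\<lambda>x. vector_derivative (\<lambda>t. h (x(i := t))) (at (x i))))"

text \<open>Smoothness on an arbitrary subset: local extendability to a smooth function.\<close>

definition smooth_on_subset ::
  "'a::euclidean_space set \<Rightarrow> ('a \<Rightarrow> 'b::real_normed_vector) \<Rightarrow> bool" where
  "smooth_on_subset S h \<longleftrightarrow>
     (\<forall>x\<in>S. \<exists>W g. open W \<and> x \<in> W \<and> (\<forall>k. Ck_on k W g) \<and> (\<forall>y\<in>W \<inter> S. g y = h y))"

text \<open>
  The smooth charts of an embedded \<open>m\<close>-dimensional submanifold \<open>M\<close> are the diffeomorphisms from
  relatively open subsets of \<open>M\<close> onto open subsets of \<open>\<real>\<^sup>m\<close>.
\<close>

definition smooth_chart ::
  "'a::euclidean_space set \<Rightarrow> nat \<Rightarrow> 'a set \<Rightarrow> ('a \<Rightarrow> nat \<Rightarrow> real) \<Rightarrow> bool" where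
  "smooth_chart M m U \<phi> \<longleftrightarrow>
     openin (top_of_set M) U \<and>
     openin (powertop_real {..<m}) (\<phi> ` U) \<and>
     inj_on \<phi> U \<and>
     (\<forall>i<m. smooth_on_subset U (\<lambda>x. \<phi> x i)) \<and>
     (\<forall>k. Ck_coord m k (\<phi> ` U) (inv_into U \<phi>))"

definition manifold_measure_zero :: "'a::euclidean_space set \<Rightarrow> nat \<Rightarrow> 'a set \<Rightarrow> bool" where
  "manifold_measure_zero M m A \<longleftrightarrow>
     (\<exists>\<C>. (\<forall>(U, \<phi>)\<in>\<C>. smooth_chart M m U \<phi> \<and>
              \<phi> ` (A \<inter> U) \<in> null_sets (completion (Pi\<^sub>M {..<m} (\<lambda>_. lborel)))) \<and>
          A \<subseteq> (\<Union>(U, \<phi>)\<in>\<C>. U))"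

end

theory Submission
  imports Defs
begin

text \<open>
  The gradient flow is the Riccati equation \<open>\<Theta>' = (I - \<Theta>\<^sup>2) / 2\<close>, and the Cayley transform
  \<open>A = 2 (I + \<Theta>)\<^sup>-\<^sup>1 - I\<close>, an involution between skew-symmetric matrices and rotations without
  eigenvalue \<open>-1\<close>, linearises it to \<open>A' = - A\<close>.  Hence every solution starting
  outside \<open>N = {\<Theta>. det (I + \<Theta>) = 0}\<close> converges to \<open>I\<close>.  Every rotation lies in the domain of
  a Cayley chart \<open>\<Theta> \<mapsto> cayley (D \<Theta>)\<close> with \<open>D\<close> a diagonal sign matrix of determinant 1, and in this
  chart \<open>N\<close> is the zero set of the polynomial \<open>det ((I + D) + (I - D) A)\<close>.  This polynomial does not
  vanish identically because \<open>D\<close> has an even number of entries \<open>-1\<close>.  So \<open>N\<close> is a null set with dense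
  complement, which also makes every equilibrium other than \<open>I\<close> unstable.  The squared distance to
  \<open>I\<close> equals \<open>2 f\<close> and so is a Lyapunov function: Barbalat's argument gives the limit sets, and a
  Gronwall estimate near \<open>I\<close> the exponential rate.
\<close>

section \<open>Matrix inversion and the Cayley transform\<close>

text \<open>With \<open>R = (I + A)^-1\<close> and \<open>\<Theta> = 2 R - I\<close>, the chain rule
  gives \<open>\<Theta>' = -2 R A' R\<close>, while the Riccati field is
  \<open>2 (R - R R) = 2 R A R\<close>; comparing the two yields \<open>A' = - A\<close>. Two
  demands of the statement shape the proof. Convergence claims concern every solution, whereas the
  Cayley formula exhibits one; uniqueness closes the gap and rests on multiplication by a rotation
  being isometric. Charts must be smooth to all orders in both directions; charts and their inverses
  are therefore built from rational matrix functions, a class closed under differentiation. The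
  parity of the sign matrices enters as follows. Where \<open>D\<close> has entry 1 the matrix
  \<open>(I + D) + (I - D) A\<close> has the row of \<open>2 I\<close>, elsewhere that of
  \<open>2 A\<close>. Its determinant is thus, up to a power of 2, the principal minor of
  \<open>A\<close> on the entries -1, and a skew-symmetric matrix can be invertible only in even
  size.\<close>

lemma bounded_bilinear_matrix_mult:
  "bounded_bilinear ((**) :: real^'n^'n \<Rightarrow> real^'n^'n \<Rightarrow> real^'n^'n)"
proof -
  have "(A + B) ** C = A ** C + B ** C" for A B C :: "real^'n^'n"
    by (simp add: matrix_matrix_mult_def vec_eq_iff sum.distrib distrib_right)
  then have "bilinear ((**) :: real^'n^'n \<Rightarrow> real^'n^'n \<Rightarrow> real^'n^'n)"
    unfolding bilinear_def
    by (auto intro!: linearI simp: matrix_add_ldistrib scalar_matrix_assoc matrix_scalar_ac)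
  then show ?thesis
    by (simp add: bilinear_conv_bounded_bilinear)
qed

lemmas matrix_mult_distribs =
  bounded_bilinear.add_left[OF bounded_bilinear_matrix_mult]
  bounded_bilinear.add_right[OF bounded_bilinear_matrix_mult]
  bounded_bilinear.diff_left[OF bounded_bilinear_matrix_mult]
  bounded_bilinear.diff_right[OF bounded_bilinear_matrix_mult]
  bounded_bilinear.minus_left[OF bounded_bilinear_matrix_mult]
  bounded_bilinear.minus_right[OF bounded_bilinear_matrix_mult]
  bounded_bilinear.scaleR_left[OF bounded_bilinear_matrix_mult]
  bounded_bilinear.scaleR_right[OF bounded_bilinear_matrix_mult]

lemmas matrix_mult_tendsto = bounded_bilinear.tendsto[OF bounded_bilinear_matrix_mult]

lemma bounded_linear_transpose: "bounded_linear (transpose :: real^'n^'n \<Rightarrow> real^'n^'n)"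
  by (subst linear_conv_bounded_linear[symmetric], intro linearI) (auto simp: transpose_def vec_eq_iff)

lemmas transpose_linear =
  linear_add[OF bounded_linear.linear[OF bounded_linear_transpose]]
  linear_diff[OF bounded_linear.linear[OF bounded_linear_transpose]]
  linear_neg[OF bounded_linear.linear[OF bounded_linear_transpose]]
  linear_cmul[OF bounded_linear.linear[OF bounded_linear_transpose]]

lemma bounded_linear_trace: "bounded_linear (trace :: real^'n^'n \<Rightarrow> real)"
  by (subst linear_conv_bounded_linear[symmetric], intro linearI)
    (auto simp: trace_def sum.distrib sum_distrib_left)

lemmas trace_linear =
  linear_add[OF bounded_linear.linear[OF bounded_linear_trace]]
  linear_diff[OF bounded_linear.linear[OF bounded_linear_trace]]
  linear_neg[OF bounded_linear.linear[OF bounded_linear_trace]]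
  linear_cmul[OF bounded_linear.linear[OF bounded_linear_trace]]

lemma trace_transpose: "trace (transpose A) = trace A" for A :: "real^'n^'n"
  by (simp add: trace_def transpose_def)

lemma inner_eq_trace: "A \<bullet> B = trace (transpose A ** B)" for A B :: "real^'n^'n"
proof -
  have "trace (transpose A ** B) = (\<Sum>i\<in>UNIV. \<Sum>k\<in>UNIV. A $ k $ i * B $ k $ i)"
    by (simp add: trace_def matrix_matrix_mult_def transpose_def)
  also have "\<dots> = A \<bullet> B"
    by (subst sum.swap) (simp add: inner_vec_def)
  finally show ?thesis ..
qed

lemma det_nonzero_iff_ker:
  fixes A :: "real^'n^'n"
  shows "det A \<noteq> 0 \<longleftrightarrow> (\<forall>x. A *v x = 0 \<longrightarrow> x = 0)"
  by (metis invertible_det_nz invertible_left_inverse matrix_left_invertible_ker)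

lemma matrix_inv_inverse:
  fixes A :: "real^'n^'n"
  assumes "det A \<noteq> 0"
  shows "A ** matrix_inv A = mat 1" and "matrix_inv A ** A = mat 1"
proof -
  have "\<exists>B. A ** B = mat 1 \<and> B ** A = mat 1"
    using assms by (simp add: invertible_det_nz[symmetric] invertible_def)
  then have "A ** matrix_inv A = mat 1 \<and> matrix_inv A ** A = mat 1"
    unfolding matrix_inv_def by (rule someI_ex)
  then show "A ** matrix_inv A = mat 1" and "matrix_inv A ** A = mat 1"
    by auto
qed

lemma matrix_inv_unique:
  fixes A :: "real^'n^'n"
  assumes "A ** B = mat 1"
  shows "matrix_inv A = B" and "det A \<noteq> 0"
proof -
  have "det A * det B = 1"
    using assms by (metis det_I det_mul)
  then show det: "det A \<noteq> 0" by auto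
  show "matrix_inv A = B"
    by (metis assms det matrix_inv_inverse(2) matrix_mul_assoc matrix_mul_lid matrix_mul_rid)
qed

lemma det_matrix_inv:
  fixes A :: "real^'n^'n"
  assumes "det A \<noteq> 0"
  shows "det (matrix_inv A) \<noteq> 0"
  by (rule matrix_inv_unique(2)[OF matrix_inv_inverse(2)[OF assms]])

lemma continuous_on_det: "continuous_on S (det :: real^'n^'n \<Rightarrow> real)"
  unfolding det_def by (intro continuous_intros)

lemma open_det_nonzero:
  fixes g :: "'a::topological_space \<Rightarrow> real^'n^'n"
  assumes "continuous_on UNIV g"
  shows "open {x. det (g x) \<noteq> 0}"
proof -
  have "continuous_on UNIV (\<lambda>x. det (g x))"
    by (rule continuous_on_compose2[OF continuous_on_det[of UNIV] assms]) simp
  then show ?thesis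
    by (intro open_Collect_neq continuous_intros)
qed

text \<open>Solving \<open>A *v x = axis l 1\<close> by Cramer's rule gives column \<open>l\<close>
  of the inverse. The entries become quotients of determinants, from which continuity of inversion
  is read off.\<close>

lemma matrix_inv_cramer:
  fixes A :: "real^'n^'n"
  assumes "det A \<noteq> 0"
  shows "matrix_inv A = (\<chi> k l. det (\<chi> i j. if j = k then axis l 1 $ i else A $ i $ j) / det A)"
proof -
  have "A *v (matrix_inv A *v axis l 1) = axis l 1" for l
    by (simp add: matrix_vector_mul_assoc matrix_inv_inverse[OF assms])
  then have "matrix_inv A *v axis l 1
      = (\<chi> k. det (\<chi> i j. if j = k then axis l 1 $ i else A $ i $ j) / det A)" for l
    using cramer[OF assms] by blast
  then have "matrix_inv A $ k $ l
      = det (\<chi> i j. if j = k then axis l 1 $ i else A $ i $ j) / det A" for k l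
    by (metis (no_types, lifting) column_def matrix_vector_mult_basis vec_lambda_beta)
  then show ?thesis
    by (simp add: vec_eq_iff)
qed

lemma isCont_matrix_inv:
  fixes A :: "real^'n^'n"
  assumes A: "det A \<noteq> 0"
  shows "isCont matrix_inv A"
proof -
  let ?G = "\<lambda>A::real^'n^'n. (\<chi> k l. det (\<chi> i j. if j = k then axis l 1 $ i else A $ i $ j) / det A) :: real^'n^'n"
  have det: "isCont (\<lambda>B::real^'n^'n. det (g B)) A" if "isCont g A" for g :: "real^'n^'n \<Rightarrow> real^'n^'n"
    using continuous_on_det[of UNIV] that
    by (metis UNIV_I continuous_on_eq_continuous_at isCont_o2 open_UNIV)
  have "isCont (\<lambda>B::real^'n^'n. \<chi> i j. if j = k then axis l 1 $ i else B $ i $ j :: real^'n^'n) A" for k l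
  proof -
    have "isCont (\<lambda>B::real^'n^'n. if j = k then axis l 1 $ i else B $ i $ j) A" for i j
      by (cases "j = k") (auto intro!: continuous_intros)
    then show ?thesis
      unfolding isCont_def by (intro tendsto_vec_lambda)
  qed
  then have "isCont ?G A"
    using A det[of "\<lambda>B. B"] det unfolding isCont_def
    by (intro tendsto_vec_lambda tendsto_divide) auto
  moreover have "\<forall>\<^sub>F B in nhds A. ?G B = matrix_inv B"
  proof -
    have "open {B::real^'n^'n. det B \<noteq> 0}"
      by (rule open_det_nonzero) (rule continuous_on_id)
    then have "\<forall>\<^sub>F B in nhds A. det B \<noteq> 0"
      using A eventually_nhds by blast
    then show ?thesis
      by eventually_elim (simp add: matrix_inv_cramer)
  qed
  ultimately show ?thesis
    by (simp only: isCont_cong)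
qed

text \<open>The resolvent identity: exact, so it turns continuity of inversion into
  differentiability.\<close>

lemma matrix_inv_diff:
  fixes A B :: "real^'n^'n"
  assumes "det A \<noteq> 0" "det B \<noteq> 0"
  shows "matrix_inv B - matrix_inv A = - (matrix_inv B ** (B - A) ** matrix_inv A)"
  using matrix_inv_inverse[OF assms(1)] matrix_inv_inverse[OF assms(2)]
  by (simp add: matrix_mult_distribs matrix_mul_assoc[symmetric])

lemma has_derivative_matrix_inv:
  fixes A :: "real^'n^'n"
  assumes A: "det A \<noteq> 0"
  shows "(matrix_inv has_derivative (\<lambda>H. - (matrix_inv A ** H ** matrix_inv A))) (at A)"
proof -
  obtain K where "K > 0" and K: "\<forall>(X::real^'n^'n) Y::real^'n^'n. norm (X ** Y) \<le> norm X * norm Y * K"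
    using bounded_bilinear.pos_bounded[OF bounded_bilinear_matrix_mult] by (elim exE conjE) (rule that)
  let ?I = "matrix_inv A"
  show ?thesis
    unfolding has_derivative_iff_norm
  proof
    show "bounded_linear (\<lambda>H. - (?I ** H ** ?I))"
      using bounded_linear_compose[OF
          bounded_bilinear.bounded_linear_left[OF bounded_bilinear_matrix_mult]
          bounded_bilinear.bounded_linear_right[OF bounded_bilinear_matrix_mult]]
      by (rule bounded_linear_minus)
    have lim: "((\<lambda>B. norm (matrix_inv B - ?I) * K * norm ?I * K) \<longlongrightarrow> 0) (at A)"
      using isCont_matrix_inv[OF A]
      by (intro tendsto_mult_left_zero tendsto_norm_zero LIM_zero) (simp add: isCont_def)
    have "open {B::real^'n^'n. det B \<noteq> 0}"
      by (rule open_det_nonzero) (rule continuous_on_id)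
    then have ev: "\<forall>\<^sub>F B in at A. det B \<noteq> 0"
      using A eventually_at_topological by blast
    have bound: "norm (matrix_inv B - ?I - (- (?I ** (B - A) ** ?I))) / norm (B - A)
         \<le> norm (matrix_inv B - ?I) * K * norm ?I * K" if "det B \<noteq> 0" for B
    proof (cases "B = A")
      case False
      \<comment> \<open>Inserting the resolvent identity leaves a remainder with the two small
        factors \<open>matrix_inv B - ?I\<close> and \<open>B - A\<close>; the second cancels
        against the denominator and the first vanishes in the limit.\<close>
      have "matrix_inv B - ?I - (- (?I ** (B - A) ** ?I)) = - ((matrix_inv B - ?I) ** (B - A) ** ?I)"
        by (subst matrix_inv_diff[OF A that]) (simp add: matrix_mult_distribs)
      also have "norm \<dots> \<le> norm (matrix_inv B - ?I) * norm (B - A) * K * norm ?I * K"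
        unfolding norm_minus_cancel
        by (rule order_trans[OF K[rule_format]]) (intro mult_right_mono K[rule_format], use \<open>K > 0\<close> in auto)
      finally show ?thesis
        using False by (simp add: divide_simps mult_ac)
    qed (use \<open>K > 0\<close> in simp)
    show "((\<lambda>B. norm (matrix_inv B - ?I - (- (?I ** (B - A) ** ?I))) / norm (B - A)) \<longlongrightarrow> 0) (at A)"
      by (rule tendsto_sandwich[OF _ _ tendsto_const lim])
        (use ev bound in \<open>auto elim!: eventually_mono\<close>)
  qed
qed

text \<open>The usual \<open>(I - A) (I + A)^-1\<close>, rewritten so that \<open>A\<close> occurs
  only once, under the inverse.\<close>

definition cayley :: "real^'n^'n \<Rightarrow> real^'n^'n" where
  "cayley A = 2 *\<^sub>R matrix_inv (mat 1 + A) - mat 1"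

text \<open>By definition \<open>mat 1 + cayley A\<close> is twice the inverse of
  \<open>mat 1 + A\<close>. This makes the transform an involution on the matrices without
  eigenvalue -1.\<close>

lemma det_one_plus_cayley:
  assumes "det (mat 1 + A) \<noteq> 0"
  shows "matrix_inv (mat 1 + cayley A) = (1/2) *\<^sub>R (mat 1 + A)" and "det (mat 1 + cayley A) \<noteq> 0"
proof -
  have "(mat 1 + cayley A) ** ((1/2) *\<^sub>R (mat 1 + A)) = mat 1"
    using matrix_inv_inverse(2)[OF assms]
    by (simp add: cayley_def matrix_mult_distribs(7,8))
  then show "matrix_inv (mat 1 + cayley A) = (1/2) *\<^sub>R (mat 1 + A)"
    and "det (mat 1 + cayley A) \<noteq> 0"
    by (rule matrix_inv_unique)+
qed

lemma cayley_cayley: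
  assumes "det (mat 1 + A) \<noteq> 0"
  shows "cayley (cayley A) = A"
  by (subst cayley_def) (simp add: det_one_plus_cayley[OF assms])

lemma cayley_zero: "cayley 0 = (mat 1 :: real^'n^'n)"
proof -
  have "matrix_inv (mat 1) = (mat 1 :: real^'n^'n)"
    by (rule matrix_inv_unique) simp
  then show ?thesis
    by (simp add: cayley_def scaleR_2)
qed

lemma has_derivative_cayley:
  assumes "det (mat 1 + A) \<noteq> 0"
  shows "(cayley has_derivative (\<lambda>H. - 2 *\<^sub>R (matrix_inv (mat 1 + A) ** H ** matrix_inv (mat 1 + A)))) (at A)"
proof -
  have "((\<lambda>A. mat 1 + A) has_derivative (\<lambda>H. H)) (at A)"
    by (rule has_derivative_eq_rhs[OF has_derivative_add[OF has_derivative_const has_derivative_ident]]) simp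
  from has_derivative_compose[OF this, of matrix_inv, OF has_derivative_matrix_inv[OF assms]]
  have "((\<lambda>A. 2 *\<^sub>R matrix_inv (mat 1 + A) - mat 1) has_derivative
      (\<lambda>H. 2 *\<^sub>R (- (matrix_inv (mat 1 + A) ** H ** matrix_inv (mat 1 + A))) - 0)) (at A)"
    by (intro has_derivative_diff has_derivative_scaleR_right has_derivative_const)
  then show ?thesis
    by (simp add: cayley_def[abs_def])
qed

lemma isCont_cayley: "det (mat 1 + A) \<noteq> 0 \<Longrightarrow> isCont cayley A"
  by (rule has_derivative_continuous[OF has_derivative_cayley])

section \<open>Skew-symmetric matrices, rotations, and the Cayley transform between them\<close>

lemma skew_symmetric_iff: "skew_symmetric A \<longleftrightarrow> transpose A = - A"
  unfolding skew_symmetric_def by (metis minus_minus)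

lemma skew_symmetric_transpose: "skew_symmetric A \<Longrightarrow> transpose A = - A"
  by (simp add: skew_symmetric_iff)

lemma skew_symmetric_scaleR: "skew_symmetric A \<Longrightarrow> skew_symmetric (c *\<^sub>R A)"
  by (simp add: skew_symmetric_iff transpose_linear)

lemma skew_symmetric_add: "skew_symmetric A \<Longrightarrow> skew_symmetric B \<Longrightarrow> skew_symmetric (A + B)"
  by (simp add: skew_symmetric_iff transpose_linear)

lemma skew_symmetric_diff: "skew_symmetric A \<Longrightarrow> skew_symmetric B \<Longrightarrow> skew_symmetric (A - B)"
  by (simp add: skew_symmetric_iff transpose_linear)

text \<open>For skew-symmetric \<open>A\<close> the form \<open>x \<bullet> (A *v x)\<close>
  vanishes, so a kernel vector of \<open>mat 1 + A\<close> satisfies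
  \<open>x \<bullet> x = 0\<close>.\<close>

lemma det_one_plus_skew:
  fixes A :: "real^'n^'n"
  assumes "skew_symmetric A"
  shows "det (mat 1 + A) \<noteq> 0"
  unfolding det_nonzero_iff_ker
proof (intro allI impI)
  fix x assume x: "(mat 1 + A) *v x = 0"
  have "x \<bullet> (A *v x) = (transpose A *v x) \<bullet> x"
    by (simp add: dot_lmul_matrix)
  also have "\<dots> = - (x \<bullet> (A *v x))"
    by (simp add: skew_symmetric_transpose[OF assms] inner_commute
        matrix_vector_mult_diff_rdistrib[of 0 A, simplified] del: transpose_matrix_vector)
  finally have "x \<bullet> (A *v x) = 0" by simp
  moreover have "x \<bullet> ((mat 1 + A) *v x) = x \<bullet> x + x \<bullet> (A *v x)"
    by (simp add: matrix_vector_mult_add_rdistrib inner_add_right)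
  ultimately show "x = 0"
    using x by simp
qed

lemma SO_orthogonal:
  assumes "\<Theta> \<in> SO"
  shows "transpose \<Theta> ** \<Theta> = mat 1" and "\<Theta> ** transpose \<Theta> = mat 1"
  using assms by (auto simp: SO_def rotation_matrix_def orthogonal_matrix_def)

lemma SO_mult: "A \<in> SO \<Longrightarrow> B \<in> SO \<Longrightarrow> A ** B \<in> SO"
  by (simp add: SO_def rotation_matrix_def orthogonal_matrix_mul det_mul)

lemma mat_1_in_SO: "mat 1 \<in> SO"
  by (simp add: SO_def rotation_matrix_def orthogonal_matrix_id)

text \<open>An orthogonal matrix of determinant -1 has eigenvalue -1: taking determinants in
  \<open>A^T (I + A) = (I + A)^T\<close> allows cancelling \<open>det (I + A)\<close>.\<close>

lemma orthogonal_in_SO: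
  fixes A :: "real^'n^'n"
  assumes orth: "transpose A ** A = mat 1" and det: "det (mat 1 + A) \<noteq> 0"
  shows "A \<in> SO"
proof -
  have "transpose A ** (mat 1 + A) = transpose (mat 1 + A)"
    by (simp add: orth matrix_mult_distribs transpose_linear)
  then have "det A * det (mat 1 + A) = det (mat 1 + A)"
    by (metis det_mul det_transpose)
  then show ?thesis
    using det orth by (simp add: SO_def rotation_matrix_def orthogonal_matrix)
qed

text \<open>With \<open>R = (I + A)^-1\<close>, orthogonality of \<open>2 R - I\<close> amounts to
  \<open>R^T + R = 2 R^T R\<close>. This holds because \<open>R^T\<close> is the inverse of
  \<open>I - A\<close> and \<open>(I + A) + (I - A) = 2 I\<close>.\<close>

lemma cayley_skew_in_SO:
  fixes A :: "real^'n^'n"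
  assumes "skew_symmetric A"
  shows "cayley A \<in> SO"
proof (rule orthogonal_in_SO)
  note det = det_one_plus_skew[OF assms]
  show "det (mat 1 + cayley A) \<noteq> 0"
    by (rule det_one_plus_cayley[OF det])
  let ?R = "matrix_inv (mat 1 + A)"
  have R: "(mat 1 + A) ** ?R = mat 1"
    by (rule matrix_inv_inverse[OF det])
  have "transpose ?R ** (mat 1 - A) = transpose ((mat 1 + A) ** ?R)"
    by (simp add: matrix_transpose_mul transpose_linear skew_symmetric_transpose[OF assms])
  then have Rt: "transpose ?R ** (mat 1 - A) = mat 1"
    by (simp add: R)
  \<comment> \<open>Each summand is padded by a product equal to the identity, so that both get the
    outer factors \<open>transpose ?R\<close> and \<open>?R\<close>.\<close>
  have "transpose ?R + ?R = transpose ?R ** ((mat 1 + A) ** ?R) + transpose ?R ** (mat 1 - A) ** ?R"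
    by (simp only: R Rt matrix_mul_lid matrix_mul_rid)
  also have "\<dots> = transpose ?R ** ((mat 1 + A) + (mat 1 - A)) ** ?R"
    by (simp only: matrix_mult_distribs matrix_mul_assoc)
  also have "(mat 1 + A) + (mat 1 - A) = 2 *\<^sub>R mat 1"
    by (simp add: scaleR_2)
  finally have sum: "transpose ?R + ?R = 2 *\<^sub>R (transpose ?R ** ?R)"
    by (simp only: matrix_mult_distribs matrix_mul_rid)
  have "transpose (cayley A) ** cayley A
      = 2 *\<^sub>R (2 *\<^sub>R (transpose ?R ** ?R) - (transpose ?R + ?R)) + mat 1"
    by (simp add: cayley_def matrix_mult_distribs transpose_linear scaleR_right_diff_distrib scaleR_add_right)
  then show "transpose (cayley A) ** cayley A = mat 1"
    by (simp only: sum diff_self scaleR_zero_right add_0)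
qed

text \<open>The converse direction: skew-symmetry of \<open>2 Q - I\<close> amounts to
  \<open>Q^T + Q = I\<close>, obtained by the same padding.\<close>

lemma skew_symmetric_cayley:
  fixes A :: "real^'n^'n"
  assumes A: "A \<in> SO" and det: "det (mat 1 + A) \<noteq> 0"
  shows "skew_symmetric (cayley A)"
proof -
  let ?Q = "matrix_inv (mat 1 + A)"
  have Q: "(mat 1 + A) ** ?Q = mat 1"
    by (rule matrix_inv_inverse[OF det])
  have "transpose ?Q ** (mat 1 + transpose A) = transpose ((mat 1 + A) ** ?Q)"
    by (simp add: matrix_transpose_mul transpose_linear)
  then have Qt: "transpose ?Q ** (mat 1 + transpose A) = mat 1"
    by (simp add: Q)
  have "transpose ?Q + ?Q = transpose ?Q ** ((mat 1 + A) ** ?Q) + transpose ?Q ** (mat 1 + transpose A) ** ?Q"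
    by (simp only: Q Qt matrix_mul_lid matrix_mul_rid)
  also have "\<dots> = transpose ?Q ** ((mat 1 + A) + (mat 1 + transpose A)) ** ?Q"
    by (simp only: matrix_mult_distribs matrix_mul_assoc)
  \<comment> \<open>Orthogonality enters here: one of the two identities in the sum is read as
    \<open>transpose A ** A\<close>, which completes a product.\<close>
  also have "(mat 1 + A) + (mat 1 + transpose A) = (mat 1 + transpose A) ** (mat 1 + A)"
    by (simp add: matrix_mult_distribs SO_orthogonal[OF A])
  also have "transpose ?Q ** ((mat 1 + transpose A) ** (mat 1 + A)) ** ?Q
      = (transpose ?Q ** (mat 1 + transpose A)) ** ((mat 1 + A) ** ?Q)"
    by (simp only: matrix_mul_assoc)
  finally have sum: "transpose ?Q + ?Q = mat 1"
    by (simp only: Q Qt matrix_mul_lid)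
  have "transpose (cayley A) + cayley A = 2 *\<^sub>R (transpose ?Q + ?Q) - 2 *\<^sub>R mat 1"
    by (simp add: cayley_def transpose_linear scaleR_add_right) (simp add: scaleR_2)
  then show ?thesis
    unfolding skew_symmetric_iff by (simp only: sum diff_self eq_neg_iff_add_eq_0)
qed

lemma norm_orthogonal_mult_left:
  fixes A B :: "real^'n^'n"
  assumes "transpose A ** A = mat 1"
  shows "norm (A ** B) = norm B"
proof -
  have "transpose (A ** B) ** (A ** B) = transpose B ** (transpose A ** A) ** B"
    by (simp add: matrix_transpose_mul matrix_mul_assoc)
  then show ?thesis
    by (simp add: norm_eq_sqrt_inner inner_eq_trace assms)
qed

lemma norm_transpose: "norm (transpose A) = norm A" for A :: "real^'n^'n"
  by (simp add: norm_eq_sqrt_inner inner_eq_trace trace_mul_sym[of A])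

lemma norm_SO_mult_left: "\<Theta> \<in> SO \<Longrightarrow> norm (\<Theta> ** B) = norm B" for B :: "real^'n^'n"
  by (simp add: norm_orthogonal_mult_left SO_orthogonal)

lemma norm_SO_mult_right:
  fixes B :: "real^'n^'n"
  assumes "\<Theta> \<in> SO"
  shows "norm (B ** \<Theta>) = norm B"
proof -
  have "norm (B ** \<Theta>) = norm (transpose \<Theta> ** transpose B)"
    by (metis norm_transpose matrix_transpose_mul)
  also have "\<dots> = norm B"
    using norm_orthogonal_mult_left[of "transpose \<Theta>"] SO_orthogonal(2)[OF assms] norm_transpose[of B]
    by simp
  finally show ?thesis .
qed

section \<open>The gradient flow\<close>

lemma SO_metric_eq_inner: "SO_metric A B = A \<bullet> B"
  by (simp add: SO_metric_def inner_eq_trace)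

text \<open>The Euclidean gradient of \<open>f\<close> is \<open>- mat 1\<close>, that is
  \<open>(- transpose \<Theta>) ** \<Theta>\<close>; projecting to the tangent space keeps the skew
  part of the left factor. Uniqueness of the gradient requires that any derivative within
  \<open>SO\<close> is determined on tangent vectors, which is tested along curves in
  \<open>SO\<close>.\<close>

lemma SO_grad_eq:
  fixes f :: "real^'n^'n \<Rightarrow> real"
  assumes f: "\<And>\<Theta>. \<Theta> \<in> SO \<Longrightarrow> f \<Theta> = real CARD('n) - trace \<Theta>" and \<Theta>: "\<Theta> \<in> SO"
  shows "SO_grad f \<Theta> = (1/2) *\<^sub>R (\<Theta> ** \<Theta> - mat 1)"
proof -
  \<comment> \<open>The skew part of \<open>- transpose \<Theta>\<close>.\<close>
  define A where "A = (1/2) *\<^sub>R (\<Theta> - transpose \<Theta>)"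
  have skewA: "skew_symmetric A"
    by (simp add: skew_symmetric_iff A_def transpose_linear scaleR_right_diff_distrib)
  have A\<Theta>: "A ** \<Theta> = (1/2) *\<^sub>R (\<Theta> ** \<Theta> - mat 1)"
    by (simp add: A_def matrix_mult_distribs SO_orthogonal[OF \<Theta>])
  have inner_A: "A \<bullet> \<Omega> = - trace (\<Omega> ** \<Theta>)" if "skew_symmetric \<Omega>" for \<Omega>
  proof -
    have "trace (transpose \<Theta> ** \<Omega>) = trace (transpose (transpose \<Theta> ** \<Omega>))"
      by (simp add: trace_transpose)
    also have "\<dots> = - trace (\<Omega> ** \<Theta>)"
      by (simp add: matrix_transpose_mul skew_symmetric_transpose[OF that] matrix_mult_distribs trace_linear)
    finally show ?thesis
      by (simp add: inner_eq_trace A_def transpose_linear matrix_mult_distribs trace_linear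
          trace_mul_sym[of \<Theta>] field_simps)
  qed
  have D: "(f has_derivative (\<lambda>H. - trace H)) (at \<Theta> within SO)"
  proof (rule has_derivative_transform_within[of "\<lambda>\<Theta>. real CARD('n) - trace \<Theta>" _ _ _ 1])
    show "((\<lambda>\<Theta>. real CARD('n) - trace \<Theta>) has_derivative (\<lambda>H. - trace H)) (at \<Theta> within SO)"
      using bounded_linear_imp_has_derivative[OF bounded_linear_trace]
      by (auto intro!: derivative_eq_intros)
  qed (use f \<Theta> in auto)
  have tangent_unique: "D' (\<Omega> ** \<Theta>) = - trace (\<Omega> ** \<Theta>)"
    if D': "(f has_derivative D') (at \<Theta> within SO)" and \<Omega>: "skew_symmetric \<Omega>" for D' \<Omega>
  proof -
    \<comment> \<open>A curve in \<open>SO\<close> through \<open>\<Theta>\<close> with velocity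
      \<open>\<Omega> ** \<Theta>\<close>. The derivative of \<open>cayley\<close> at 0 is
      \<open>-2\<close> times the identity, whence the factor \<open>- t / 2\<close>.\<close>
    define \<gamma> where "\<gamma> t = cayley ((- t / 2) *\<^sub>R \<Omega>) ** \<Theta>" for t :: real
    have \<gamma>_SO: "\<gamma> t \<in> SO" for t
      unfolding \<gamma>_def by (intro SO_mult cayley_skew_in_SO skew_symmetric_scaleR \<Omega> \<Theta>)
    have \<gamma>0: "\<gamma> 0 = \<Theta>"
      by (simp add: \<gamma>_def cayley_zero)
    have inv1: "matrix_inv (mat 1) = (mat 1 :: real^'n^'n)"
      by (rule matrix_inv_unique) simp
    have l: "((\<lambda>t::real. (- t / 2) *\<^sub>R \<Omega>) has_derivative (\<lambda>t. (- t / 2) *\<^sub>R \<Omega>)) (at 0)"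
      by (auto intro!: derivative_eq_intros)
    have c: "((\<lambda>t::real. cayley ((- t / 2) *\<^sub>R \<Omega>)) has_derivative (\<lambda>t. t *\<^sub>R \<Omega>)) (at 0)"
    proof (rule has_derivative_eq_rhs[OF has_derivative_compose[OF l]])
      show "(cayley has_derivative (\<lambda>H. - 2 *\<^sub>R H)) (at ((- 0 / 2) *\<^sub>R \<Omega>))"
        using has_derivative_cayley[of "0::real^'n^'n"] by (simp add: inv1)
    qed simp
    have \<gamma>': "(\<gamma> has_derivative (\<lambda>t. t *\<^sub>R (\<Omega> ** \<Theta>))) (at 0)"
      using bounded_linear.has_derivative[OF
          bounded_bilinear.bounded_linear_left[OF bounded_bilinear_matrix_mult] c]
      by (simp add: \<gamma>_def[abs_def] matrix_mult_distribs)
    have "((\<lambda>t. f (\<gamma> t)) has_derivative (\<lambda>t. D' (t *\<^sub>R (\<Omega> ** \<Theta>)))) (at 0)"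
      by (rule has_derivative_in_compose[OF \<gamma>' has_derivative_subset])
        (use D' \<gamma>_SO in \<open>auto simp: \<gamma>0\<close>)
    moreover have "((\<lambda>t. f (\<gamma> t)) has_derivative (\<lambda>t. - trace (t *\<^sub>R (\<Omega> ** \<Theta>)))) (at 0)"
      by (rule has_derivative_in_compose[OF \<gamma>' has_derivative_subset])
        (use D \<gamma>_SO in \<open>auto simp: \<gamma>0\<close>)
    ultimately have "(\<lambda>t. D' (t *\<^sub>R (\<Omega> ** \<Theta>))) = (\<lambda>t. - trace (t *\<^sub>R (\<Omega> ** \<Theta>)))"
      by (rule has_derivative_unique)
    from fun_cong[OF this, of 1] show ?thesis by simp
  qed
  have inner_right: "(B ** \<Theta>) \<bullet> (\<Omega> ** \<Theta>) = B \<bullet> \<Omega>" for B \<Omega> :: "real^'n^'n"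
    using SO_metric_right_translate[OF \<Theta>, of B \<Omega>] by (simp add: SO_metric_eq_inner inner_eq_trace)
  have "SO_grad f \<Theta> = A ** \<Theta>"
    unfolding SO_grad_def
  proof (rule the_equality)
    show "is_SO_gradient f \<Theta> (A ** \<Theta>)"
      unfolding is_SO_gradient_def SO_tangent_space_def SO_metric_eq_inner inner_right
      using D inner_A skewA by force
  next
    fix V assume "is_SO_gradient f \<Theta> V"
    then obtain B D' where V: "V = B ** \<Theta>" and B: "skew_symmetric B"
      and D': "(f has_derivative D') (at \<Theta> within SO)"
      and *: "\<And>\<Omega>. skew_symmetric \<Omega> \<Longrightarrow> D' (\<Omega> ** \<Theta>) = B \<bullet> \<Omega>"
      unfolding is_SO_gradient_def SO_tangent_space_def SO_metric_eq_inner
      by (elim conjE CollectE exE) (auto simp: inner_right intro!: that)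
    have "(B - A) \<bullet> \<Omega> = 0" if "skew_symmetric \<Omega>" for \<Omega>
      using *[OF that] tangent_unique[OF D' that] inner_A[OF that] by (simp add: inner_diff_left)
    from this[OF skew_symmetric_diff[OF B skewA]] show "V = A ** \<Theta>"
      by (simp add: V)
  qed
  then show ?thesis
    by (simp add: A\<Theta>)
qed

text \<open>The negative gradient on \<open>SO\<close>, as a polynomial defined on all
  matrices.\<close>

definition trace_flow :: "real^'n^'n \<Rightarrow> real^'n^'n" where
  "trace_flow \<Theta> = (1/2) *\<^sub>R (mat 1 - \<Theta> ** \<Theta>)"

lemma closed_SO: "closed (SO :: (real^'n^'n) set)"
proof -
  have eq: "SO = {A::real^'n^'n. transpose A ** A = mat 1} \<inter> {A. det A = 1}"
    by (auto simp: SO_def rotation_matrix_def orthogonal_matrix)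
  show ?thesis
    unfolding eq
    by (intro closed_Int closed_Collect_eq continuous_on_const continuous_on_det continuous_on_id
        bounded_bilinear.continuous_on[OF bounded_bilinear_matrix_mult]
        linear_continuous_on[OF bounded_linear_transpose])
qed

lemma SO_inner_self: "\<Theta> \<in> SO \<Longrightarrow> \<Theta> \<bullet> \<Theta> = real CARD('n)" for \<Theta> :: "real^'n^'n"
  by (simp add: inner_eq_trace SO_orthogonal trace_I)

lemma norm_SO: "\<Theta> \<in> SO \<Longrightarrow> norm \<Theta> = sqrt (real CARD('n))" for \<Theta> :: "real^'n^'n"
  by (simp add: norm_eq_sqrt_inner SO_inner_self)

lemma trace_square_SO_le: "\<Theta> \<in> SO \<Longrightarrow> trace (\<Theta> ** \<Theta>) \<le> real CARD('n)" for \<Theta> :: "real^'n^'n"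
proof -
  assume "\<Theta> \<in> SO"
  then have "transpose \<Theta> \<bullet> \<Theta> \<le> real CARD('n)"
    using norm_cauchy_schwarz[of "transpose \<Theta>" \<Theta>] by (simp add: norm_transpose norm_SO)
  then show ?thesis
    by (simp add: inner_eq_trace)
qed

text \<open>The defect \<open>n - trace (\<Theta> ** \<Theta>)\<close> is half the squared norm of
  \<open>transpose \<Theta> - \<Theta>\<close>. It reappears as the rate at which the squared
  distance to \<open>mat 1\<close> decreases.\<close>

lemma trace_square_SO_eq_iff:
  fixes \<Theta> :: "real^'n^'n"
  assumes "\<Theta> \<in> SO"
  shows "trace (\<Theta> ** \<Theta>) = real CARD('n) \<longleftrightarrow> transpose \<Theta> = \<Theta>"
proof -
  have "transpose \<Theta> \<bullet> transpose \<Theta> = real CARD('n)"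
    using norm_transpose[of \<Theta>] SO_inner_self[OF assms] by (simp add: norm_eq_sqrt_inner)
  then have "(transpose \<Theta> - \<Theta>) \<bullet> (transpose \<Theta> - \<Theta>) = 2 * (real CARD('n) - trace (\<Theta> ** \<Theta>))"
    using SO_inner_self[OF assms]
    by (simp add: inner_diff_left inner_diff_right inner_commute[of \<Theta> "transpose \<Theta>"])
      (simp add: inner_eq_trace)
  then show ?thesis
    by (metis eq_iff_diff_eq_0 inner_eq_zero_iff mult_eq_0_iff zero_neq_numeral)
qed

lemma trace_flow_eq_0_iff:
  fixes \<Theta> :: "real^'n^'n"
  assumes "\<Theta> \<in> SO"
  shows "trace_flow \<Theta> = 0 \<longleftrightarrow> transpose \<Theta> = \<Theta>"
proof
  assume "trace_flow \<Theta> = 0"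
  then have "\<Theta> ** \<Theta> = mat 1"
    by (simp add: trace_flow_def)
  then show "transpose \<Theta> = \<Theta>"
    by (metis SO_orthogonal(1)[OF assms] matrix_mul_assoc matrix_mul_lid matrix_mul_rid)
next
  assume "transpose \<Theta> = \<Theta>"
  then show "trace_flow \<Theta> = 0"
    using SO_orthogonal(1)[OF assms] by (simp add: trace_flow_def)
qed

text \<open>The explicit formula supplies existence for all \<open>t \<ge> 0\<close>.\<close>

lemma flow_solution_cayley:
  fixes A :: "real^'n^'n"
  assumes A: "skew_symmetric A"
  shows "flow_solution SO trace_flow (\<lambda>t. cayley (exp (- t) *\<^sub>R A))"
  unfolding flow_solution_def
proof (intro allI impI conjI)
  fix t :: real assume "t \<ge> 0"
  let ?A = "exp (- t) *\<^sub>R A"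
  let ?R = "matrix_inv (mat 1 + ?A)"
  have skew: "skew_symmetric ?A"
    by (rule skew_symmetric_scaleR[OF A])
  show "cayley ?A \<in> SO"
    by (rule cayley_skew_in_SO[OF skew])
  have "((\<lambda>t. exp (- t) *\<^sub>R A) has_vector_derivative - ?A) (at t within {0..})"
    by (auto intro!: derivative_eq_intros)
  then have "((\<lambda>t. exp (- t) *\<^sub>R A) has_derivative (\<lambda>h. h *\<^sub>R (- ?A))) (at t within {0..})"
    by (simp add: has_vector_derivative_def)
  from has_derivative_compose[OF this has_derivative_cayley[OF det_one_plus_skew[OF skew]]]
  have deriv: "((\<lambda>t. cayley (exp (- t) *\<^sub>R A)) has_derivative
      (\<lambda>h. - 2 *\<^sub>R (?R ** (h *\<^sub>R (- ?A)) ** ?R))) (at t within {0..})" .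
  \<comment> \<open>Writing \<open>?A\<close> as \<open>(mat 1 + ?A) - mat 1\<close> removes it and
    leaves the quadratic expression in \<open>?R\<close> that the Riccati field produces.\<close>
  have "?R ** ?A ** ?R = ?R ** ((mat 1 + ?A) ** ?R) - ?R ** ?R"
    by (simp add: matrix_mult_distribs matrix_mul_assoc)
  also have "\<dots> = ?R - ?R ** ?R"
    by (simp only: matrix_inv_inverse[OF det_one_plus_skew[OF skew]] matrix_mul_rid)
  finally have RAR: "?R ** ?A ** ?R = ?R - ?R ** ?R" .
  have "trace_flow (cayley ?A) = 2 *\<^sub>R (?R - ?R ** ?R)"
    by (simp add: trace_flow_def cayley_def matrix_mult_distribs algebra_simps)
  then have trace_flow: "trace_flow (cayley ?A) = 2 *\<^sub>R (?R ** ?A ** ?R)"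
    by (simp only: RAR)
  have "- 2 *\<^sub>R (?R ** (h *\<^sub>R (- ?A)) ** ?R) = h *\<^sub>R trace_flow (cayley ?A)" for h
    unfolding trace_flow by (simp add: matrix_mult_distribs mult_ac)
  then show "((\<lambda>t. cayley (exp (- t) *\<^sub>R A)) has_vector_derivative trace_flow (cayley ?A)) (at t within {0..})"
    using deriv unfolding has_vector_derivative_def by simp
qed

lemma cayley_flow_tendsto:
  fixes A :: "real^'n^'n"
  shows "((\<lambda>t. cayley (exp (- t) *\<^sub>R A)) \<longlongrightarrow> mat 1) at_top"
proof -
  have "isCont cayley (0::real^'n^'n)"
    by (rule isCont_cayley) simp
  moreover have "((\<lambda>t::real. exp (- t) *\<^sub>R A) \<longlongrightarrow> 0 *\<^sub>R A) at_top"
    by (intro tendsto_scaleR tendsto_const filterlim_compose[OF exp_at_bot filterlim_uminus_at_bot_at_top])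
  ultimately have "((\<lambda>t. cayley (exp (- t) *\<^sub>R A)) \<longlongrightarrow> cayley 0) at_top"
    by (metis isCont_tendsto_compose scaleR_zero_left)
  then show ?thesis
    by (simp add: cayley_zero)
qed

section \<open>Differential inequalities and Barbalat's argument on the half-line\<close>

lemma nonincreasing_on_halfline:
  fixes u u' :: "real \<Rightarrow> real"
  assumes deriv: "\<And>t. t \<ge> 0 \<Longrightarrow> (u has_real_derivative u' t) (at t within {0..})"
    and nonpos: "\<And>t. t \<ge> 0 \<Longrightarrow> u' t \<le> 0"
    and st: "0 \<le> s" "s \<le> t"
  shows "u t \<le> u s"
proof (rule DERIV_nonpos_imp_decreasing_open[OF \<open>s \<le> t\<close>])
  fix x assume "s < x" "x < t"
  then have "at x within {0..} = at x"
    using st by (intro at_within_interior) auto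
  then show "\<exists>y. DERIV u x :> y \<and> y \<le> 0"
    using deriv[of x] nonpos[of x] \<open>s < x\<close> st by auto
next
  have "continuous_on {0..} u"
    using deriv by (intro DERIV_continuous_on) auto
  then show "continuous_on {s..t} u"
    by (rule continuous_on_subset) (use st in auto)
qed

text \<open>The sign of \<open>c\<close> is free: \<open>c = 2\<close> serves uniqueness,
  \<open>c = -1\<close> the decay near \<open>mat 1\<close>.\<close>

lemma gronwall_halfline:
  fixes u u' :: "real \<Rightarrow> real"
  assumes deriv: "\<And>t. t \<ge> 0 \<Longrightarrow> (u has_real_derivative u' t) (at t within {0..})"
    and bound: "\<And>t. t \<ge> 0 \<Longrightarrow> u' t \<le> c * u t"
    and "t \<ge> 0"
  shows "u t \<le> exp (c * t) * u 0"
proof -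
  have "exp (- c * t) * u t \<le> exp (- c * 0) * u 0"
  proof (rule nonincreasing_on_halfline[of "\<lambda>t. exp (- c * t) * u t" "\<lambda>t. exp (- c * t) * (u' t - c * u t)"])
    fix t :: real assume "t \<ge> 0"
    then show "((\<lambda>t. exp (- c * t) * u t) has_real_derivative exp (- c * t) * (u' t - c * u t)) (at t within {0..})"
      by (auto intro!: derivative_eq_intros deriv simp: algebra_simps)
    show "exp (- c * t) * (u' t - c * u t) \<le> 0"
      using bound[OF \<open>t \<ge> 0\<close>] by (simp add: mult_le_0_iff)
  qed (use \<open>t \<ge> 0\<close> in auto)
  then have "exp (c * t) * (exp (- c * t) * u t) \<le> exp (c * t) * u 0"
    by simp
  then show ?thesis
    by (simp flip: mult.assoc exp_add)
qed

text \<open>Since \<open>d\<close> cannot fall faster than \<open>C\<close>, a large value of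
  \<open>d\<close> persists for a while and costs \<open>u\<close> a fixed amount. A nonincreasing
  \<open>u\<close> bounded below can pay this only finitely often.\<close>

lemma barbalat:
  fixes u d d' :: "real \<Rightarrow> real"
  assumes u: "\<And>t. t \<ge> 0 \<Longrightarrow> (u has_real_derivative - d t) (at t within {0..})"
    and d: "\<And>t. t \<ge> 0 \<Longrightarrow> (d has_real_derivative d' t) (at t within {0..})"
    and d_nonneg: "\<And>t. t \<ge> 0 \<Longrightarrow> 0 \<le> d t"
    and u_nonneg: "\<And>t. t \<ge> 0 \<Longrightarrow> 0 \<le> u t"
    and d'_bound: "\<And>t. t \<ge> 0 \<Longrightarrow> - C \<le> d' t" and "C > 0"
  shows "(d \<longlongrightarrow> 0) at_top"
proof (rule order_tendstoI)
  fix a :: real assume "a < 0"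
  then show "\<forall>\<^sub>F t in at_top. a < d t"
    using d_nonneg by (intro eventually_at_top_linorderI[of 0]) (meson less_le_trans)
next
  fix \<epsilon> :: real assume "0 < \<epsilon>"
  \<comment> \<open>Over a time \<open>h\<close> the function \<open>d\<close> loses at most
    \<open>C * h = \<epsilon> / 2\<close>, so \<open>d t \<ge> \<epsilon>\<close> would make
    \<open>u\<close> drop by at least \<open>h * (\<epsilon> / 2)\<close>.\<close>
  define h where "h = \<epsilon> / (2 * C)"
  have "h > 0"
    using \<open>\<epsilon> > 0\<close> \<open>C > 0\<close> by (simp add: h_def)
  have drop: "h * (d t - C * h) \<le> u t - u (t + h)" if "t \<ge> 0" for t
  proof -
    have d_lower: "d t - C * (s - t) \<le> d s" if "s \<ge> t" for s
    proof -
      have "- d s - C * s \<le> - d t - C * t"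
        by (rule nonincreasing_on_halfline[of "\<lambda>s. - d s - C * s" "\<lambda>s. - d' s - C"])
          (use d d'_bound \<open>t \<ge> 0\<close> that in \<open>auto intro!: derivative_eq_intros simp: minus_le_iff\<close>)
      then show ?thesis
        by (simp add: algebra_simps)
    qed
    \<comment> \<open>Adding the guaranteed linear loss to \<open>u\<close> still gives a
      nonincreasing function; comparing its values at 0 and \<open>h\<close> is the claimed
      drop.\<close>
    define v where "v s = u (t + s) + s * (d t - C * h)" for s
    have "v h \<le> v 0"
    proof (rule DERIV_nonpos_imp_decreasing_open[where f = v and a = 0 and b = h])
      fix s assume s: "0 < s" "s < h"
      then have "at (t + s) within {0..} = at (t + s)"
        using \<open>t \<ge> 0\<close> by (intro at_within_interior) auto
      then have "DERIV u (t + s) :> - d (t + s)"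
        using u[of "t + s"] s \<open>t \<ge> 0\<close> by simp
      then have "DERIV (\<lambda>s. u (s + t)) s :> - d (t + s)"
        by (simp add: DERIV_shift add.commute)
      then have "DERIV v s :> - d (t + s) + (d t - C * h)"
        unfolding v_def[abs_def] by (auto intro!: derivative_eq_intros simp: add.commute)
      moreover have "d t - C * s \<le> d (t + s)" and "C * s \<le> C * h"
        using d_lower[of "t + s"] s \<open>C > 0\<close> by simp_all
      then have "- d (t + s) + (d t - C * h) \<le> 0"
        by linarith
      ultimately show "\<exists>y. DERIV v s :> y \<and> y \<le> 0" by blast
    next
      have "continuous_on {0..} u"
        using u by (intro DERIV_continuous_on) auto
      then have "continuous_on {0..h} (\<lambda>s. u (t + s))"
        by (rule continuous_on_compose2) (use \<open>t \<ge> 0\<close> in \<open>auto intro: continuous_on_add continuous_on_const continuous_on_id\<close>)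
      then show "continuous_on {0..h} v"
        unfolding v_def[abs_def]
        by (intro continuous_on_add continuous_on_mult_right continuous_on_id)
    qed (use \<open>h > 0\<close> in simp)
    then show ?thesis
      by (simp add: v_def)
  qed
  have mono: "u t \<le> u s" if "0 \<le> s" "s \<le> t" for s t
    by (rule nonincreasing_on_halfline[of u "\<lambda>t. - d t"]) (use u d_nonneg that in auto)
  \<comment> \<open>Once \<open>u\<close> is within \<open>h * (\<epsilon> / 2)\<close> of its
    infimum, no drop of that size remains possible.\<close>
  define m where "m = (INF t\<in>{0..}. u t)"
  have bdd: "bdd_below (u ` {0..})"
    using u_nonneg by (intro bdd_belowI[of _ 0]) auto
  have "m < m + h * (\<epsilon> / 2)"
    using \<open>h > 0\<close> \<open>\<epsilon> > 0\<close> by simp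
  then have "\<exists>T\<in>{0..}. u T < m + h * (\<epsilon> / 2)"
    using cINF_less_iff[OF _ bdd, of "m + h * (\<epsilon> / 2)"] by (auto simp: m_def)
  then obtain T where T: "T \<ge> 0" "u T < m + h * (\<epsilon> / 2)"
    by auto
  have "d t < \<epsilon>" if "t \<ge> T" for t
  proof -
    have "m \<le> u (t + h)"
      unfolding m_def using T that \<open>h > 0\<close> by (intro cINF_lower bdd) auto
    moreover have "u t \<le> u T"
      using mono T that by simp
    ultimately have "h * (d t - C * h) < h * (\<epsilon> / 2)"
      using drop[of t] T that by simp
    then have "d t - C * h < \<epsilon> / 2"
      using \<open>h > 0\<close> by simp
    then show ?thesis
      using \<open>C > 0\<close> by (simp add: h_def)
  qed
  then show "\<forall>\<^sub>F t in at_top. d t < \<epsilon>"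
    by (rule eventually_at_top_linorderI)
qed

section \<open>Uniqueness, limit sets and exponential decay for the Riccati flow\<close>

lemma flow_solutionD:
  assumes "flow_solution M X \<theta>" "t \<ge> 0"
  shows "\<theta> t \<in> M" and "(\<theta> has_vector_derivative X (\<theta> t)) (at t within {0..})"
  using assms by (auto simp: flow_solution_def)

lemma has_real_derivative_norm_square:
  fixes g :: "real \<Rightarrow> 'a::real_inner"
  assumes "(g has_vector_derivative g') (at t within S)"
  shows "((\<lambda>t. (norm (g t))\<^sup>2) has_real_derivative 2 * (g t \<bullet> g')) (at t within S)"
proof -
  have "((\<lambda>t. g t \<bullet> g t) has_vector_derivative g t \<bullet> g' + g' \<bullet> g t) (at t within S)"
    by (rule bounded_bilinear.has_vector_derivative[OF bounded_bilinear_inner assms assms])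
  then show ?thesis
    by (simp add: has_real_derivative_iff_has_vector_derivative power2_norm_eq_inner inner_commute)
qed

text \<open>A difference of squares splits as \<open>X X - Y Y = X (X - Y) + (X - Y) Y\<close>. As
  rotations act isometrically on both sides, the field is 1-Lipschitz on \<open>SO\<close>, and the
  squared distance grows at rate at most 2.\<close>

lemma trace_flow_solution_unique:
  fixes \<theta> \<eta> :: "real \<Rightarrow> real^'n^'n"
  assumes \<theta>: "flow_solution SO trace_flow \<theta>" and \<eta>: "flow_solution SO trace_flow \<eta>"
    and init: "\<theta> 0 = \<eta> 0" and "t \<ge> 0"
  shows "\<theta> t = \<eta> t"
proof -
  let ?u = "\<lambda>t. (norm (\<theta> t - \<eta> t))\<^sup>2"
  have "?u t \<le> exp (2 * t) * ?u 0"
  proof (rule gronwall_halfline[OF _ _ \<open>t \<ge> 0\<close>])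
    fix t :: real assume "t \<ge> 0"
    note \<theta>t = flow_solutionD[OF \<theta> \<open>t \<ge> 0\<close>] and \<eta>t = flow_solutionD[OF \<eta> \<open>t \<ge> 0\<close>]
    show "(?u has_real_derivative 2 * ((\<theta> t - \<eta> t) \<bullet> (trace_flow (\<theta> t) - trace_flow (\<eta> t))))
        (at t within {0..})"
      by (intro has_real_derivative_norm_square has_vector_derivative_diff \<theta>t \<eta>t)
    have "trace_flow (\<theta> t) - trace_flow (\<eta> t)
        = (- 1/2) *\<^sub>R (\<theta> t ** (\<theta> t - \<eta> t) + (\<theta> t - \<eta> t) ** \<eta> t)"
      by (simp add: trace_flow_def matrix_mult_distribs scaleR_right_diff_distrib)
    also have "norm \<dots> \<le> (1/2) * (norm (\<theta> t ** (\<theta> t - \<eta> t)) + norm ((\<theta> t - \<eta> t) ** \<eta> t))"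
      using norm_triangle_ineq by simp
    also have "\<dots> = norm (\<theta> t - \<eta> t)"
      using norm_SO_mult_left[OF \<theta>t(1)] norm_SO_mult_right[OF \<eta>t(1)] by simp
    finally have "norm (\<theta> t - \<eta> t) * norm (trace_flow (\<theta> t) - trace_flow (\<eta> t)) \<le> ?u t"
      by (simp add: power2_eq_square mult_left_mono)
    then show "2 * ((\<theta> t - \<eta> t) \<bullet> (trace_flow (\<theta> t) - trace_flow (\<eta> t))) \<le> 2 * ?u t"
      using norm_cauchy_schwarz[of "\<theta> t - \<eta> t" "trace_flow (\<theta> t) - trace_flow (\<eta> t)"] by simp
  qed
  then show ?thesis
    by (simp add: init)
qed

text \<open>Uniqueness identifies an arbitrary solution with the Cayley one, which excludes a second
  solution from the same point tending elsewhere.\<close>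

lemma trace_flow_converges:
  fixes \<theta> :: "real \<Rightarrow> real^'n^'n"
  assumes \<theta>: "flow_solution SO trace_flow \<theta>" and det: "det (mat 1 + \<theta> 0) \<noteq> 0"
  shows "(\<theta> \<longlongrightarrow> mat 1) at_top"
proof -
  let ?A = "cayley (\<theta> 0)"
  have "skew_symmetric ?A"
    using flow_solutionD(1)[OF \<theta>, of 0] det by (simp add: skew_symmetric_cayley)
  then have sol: "flow_solution SO trace_flow (\<lambda>t. cayley (exp (- t) *\<^sub>R ?A))"
    by (rule flow_solution_cayley)
  have "\<theta> 0 = cayley (exp (- 0) *\<^sub>R ?A)"
    by (simp add: cayley_cayley[OF det])
  then have eq: "\<theta> t = cayley (exp (- t) *\<^sub>R ?A)" if "t \<ge> 0" for t
    using that by (rule trace_flow_solution_unique[OF \<theta> sol])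
  have "\<forall>\<^sub>F t in at_top. cayley (exp (- t) *\<^sub>R ?A) = \<theta> t"
    by (rule eventually_at_top_linorderI[of 0]) (rule eq[symmetric])
  then show ?thesis
    by (rule Lim_transform_eventually[OF cayley_flow_tendsto])
qed

text \<open>The contribution of \<open>\<Theta>\<close> itself vanishes, because the norm is
  constant on \<open>SO\<close> and the field is tangent; only \<open>mat 1\<close>
  contributes.\<close>

lemma inner_trace_flow:
  fixes \<Theta> :: "real^'n^'n"
  assumes "\<Theta> \<in> SO"
  shows "2 * ((\<Theta> - mat 1) \<bullet> trace_flow \<Theta>) = - (real CARD('n) - trace (\<Theta> ** \<Theta>))"
  by (simp add: trace_flow_def inner_eq_trace transpose_linear matrix_mult_distribs trace_linear
      SO_orthogonal[OF assms] matrix_mul_assoc trace_I trace_transpose)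

lemma trace_flow_norm_square_derivative:
  fixes \<theta> :: "real \<Rightarrow> real^'n^'n"
  assumes \<theta>: "flow_solution SO trace_flow \<theta>" and "t \<ge> 0"
  shows "((\<lambda>t. (norm (\<theta> t - mat 1))\<^sup>2) has_real_derivative
    - (real CARD('n) - trace (\<theta> t ** \<theta> t))) (at t within {0..})"
proof -
  note \<theta>t = flow_solutionD[OF \<theta> \<open>t \<ge> 0\<close>]
  have "((\<lambda>t. (norm (\<theta> t - mat 1))\<^sup>2) has_real_derivative 2 * ((\<theta> t - mat 1) \<bullet> (trace_flow (\<theta> t) - 0)))
      (at t within {0..})"
    by (intro has_real_derivative_norm_square has_vector_derivative_diff \<theta>t has_vector_derivative_const)
  then show ?thesis
    by (simp only: diff_0_right inner_trace_flow[OF \<theta>t(1)])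
qed

text \<open>The defect \<open>n - trace (\<Theta> ** \<Theta>)\<close> tends to 0 along the
  solution, hence vanishes at every limit point by continuity, which forces symmetry.\<close>

lemma trace_flow_omega_limit:
  fixes \<theta> :: "real \<Rightarrow> real^'n^'n"
  assumes \<theta>: "flow_solution SO trace_flow \<theta>" and p: "p \<in> omega_limit_set \<theta>"
  shows "p \<in> SO" and "transpose p = p"
proof -
  let ?n = "real CARD('n)"
  let ?d = "\<lambda>t. ?n - trace (\<theta> t ** \<theta> t)"
  let ?d' = "\<lambda>t. - trace (\<theta> t ** trace_flow (\<theta> t) + trace_flow (\<theta> t) ** \<theta> t)"
  note \<theta>t = flow_solutionD[OF \<theta>]
  have d_tendsto: "(?d \<longlongrightarrow> 0) at_top"
  proof (rule barbalat[of "\<lambda>t. (norm (\<theta> t - mat 1))\<^sup>2" ?d ?d' "2 * ?n"])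
    fix t :: real assume t: "t \<ge> 0"
    show "((\<lambda>t. (norm (\<theta> t - mat 1))\<^sup>2) has_real_derivative - ?d t) (at t within {0..})"
      by (rule trace_flow_norm_square_derivative[OF \<theta> t])
    have "((\<lambda>t. trace (\<theta> t ** \<theta> t)) has_vector_derivative
        trace (\<theta> t ** trace_flow (\<theta> t) + trace_flow (\<theta> t) ** \<theta> t)) (at t within {0..})"
      by (intro bounded_linear.has_vector_derivative[OF bounded_linear_trace]
          bounded_bilinear.has_vector_derivative[OF bounded_bilinear_matrix_mult] \<theta>t t)
    then have "((\<lambda>t. trace (\<theta> t ** \<theta> t)) has_real_derivative
        trace (\<theta> t ** trace_flow (\<theta> t) + trace_flow (\<theta> t) ** \<theta> t)) (at t within {0..})"
      by (simp add: has_real_derivative_iff_has_vector_derivative)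
    then show "(?d has_real_derivative ?d' t) (at t within {0..})"
      by (auto intro!: derivative_eq_intros)
    show "0 \<le> ?d t"
      using trace_square_SO_le[OF \<theta>t(1)[OF t]] by simp
    show "0 \<le> (norm (\<theta> t - mat 1))\<^sup>2" by simp
    \<comment> \<open>Rotations have norm \<open>sqrt ?n\<close>, so Cauchy-Schwarz and the triangle
      inequality give the constant \<open>2 * ?n\<close>.\<close>
    have "trace (\<theta> t ** trace_flow (\<theta> t) + trace_flow (\<theta> t) ** \<theta> t)
        = 2 * trace (\<theta> t ** trace_flow (\<theta> t))"
      by (simp only: trace_linear(1) trace_mul_sym[of "trace_flow (\<theta> t)"] mult_2)
    also have "\<dots> = transpose (\<theta> t) \<bullet> (mat 1 - \<theta> t ** \<theta> t)"
      by (simp add: trace_flow_def inner_eq_trace matrix_mult_distribs(8) trace_linear(4))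
    also have "\<dots> \<le> norm (transpose (\<theta> t)) * norm (mat 1 - \<theta> t ** \<theta> t)"
      by (rule norm_cauchy_schwarz)
    also have "\<dots> \<le> sqrt ?n * (sqrt ?n + sqrt ?n)"
      using norm_triangle_ineq4[of "mat 1 :: real^'n^'n" "\<theta> t ** \<theta> t"] \<theta>t(1)[OF t]
      by (intro mult_mono) (simp_all add: norm_transpose norm_SO mat_1_in_SO SO_mult)
    also have "\<dots> = 2 * ?n"
      by (simp add: algebra_simps)
    finally show "- (2 * ?n) \<le> ?d' t" by simp
  qed simp
  from p obtain s where s: "filterlim s at_top sequentially" and lim: "(\<lambda>k. \<theta> (s k)) \<longlonglongrightarrow> p"
    by (auto simp: omega_limit_set_def)
  have "\<forall>\<^sub>F k in sequentially. \<theta> (s k) \<in> SO"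
    using s \<theta>t(1) by (auto simp: filterlim_at_top elim!: eventually_mono dest!: spec[of _ 0])
  then show "p \<in> SO"
    by (rule Lim_in_closed_set[OF closed_SO _ _ lim]) simp
  have "(\<lambda>k. ?d (s k)) \<longlonglongrightarrow> ?n - trace (p ** p)"
    by (intro tendsto_diff tendsto_const bounded_linear.tendsto[OF bounded_linear_trace] matrix_mult_tendsto lim)
  moreover have "(\<lambda>k. ?d (s k)) \<longlonglongrightarrow> 0"
    by (rule filterlim_compose[OF d_tendsto s])
  ultimately have "?n - trace (p ** p) = 0"
    by (rule LIMSEQ_unique)
  then show "transpose p = p"
    using trace_square_SO_eq_iff[OF \<open>p \<in> SO\<close>] by simp
qed

text \<open>With \<open>E = \<Theta> - I\<close> the field is \<open>- E - E E / 2\<close>, so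
  \<open>y = |E|^2\<close> satisfies \<open>y' = - 2 y - E \<bullet> (E E)\<close>. In the ball of
  radius \<open>1 / K\<close>, with \<open>K\<close> a bound for the product, the cubic term is at
  most \<open>y\<close>. Thus \<open>y' \<le> - y\<close>, which is rate 1/2 for the
  distance.\<close>

lemma trace_flow_exponentially_stable:
  "locally_exponentially_stable SO trace_flow (mat 1 :: real^'n^'n)"
proof -
  obtain K where "K > 0" and K: "\<forall>(A::real^'n^'n) B::real^'n^'n. norm (A ** B) \<le> norm A * norm B * K"
    using bounded_bilinear.pos_bounded[OF bounded_bilinear_matrix_mult] by (elim exE conjE) (rule that)
  have decay: "dist (\<theta> t) (mat 1) \<le> 1 * exp (- (1/2) * t) * dist (\<theta> 0) (mat 1)"
    if \<theta>: "flow_solution SO trace_flow \<theta>" and init: "dist (\<theta> 0) (mat 1) < 1 / K" and "t \<ge> 0"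
    for \<theta> :: "real \<Rightarrow> real^'n^'n" and t
  proof -
    let ?y = "\<lambda>t. (norm (\<theta> t - mat 1))\<^sup>2"
    let ?d = "\<lambda>t. real CARD('n) - trace (\<theta> t ** \<theta> t)"
    \<comment> \<open>The distance to \<open>mat 1\<close> never increases on \<open>SO\<close>, so
      the solution stays in the ball where the cubic term is controlled.\<close>
    have small: "norm (\<theta> t - mat 1) < 1 / K" if "t \<ge> 0" for t
    proof -
      have "?y t \<le> ?y 0"
        by (rule nonincreasing_on_halfline[OF trace_flow_norm_square_derivative[OF \<theta>]])
          (use that trace_square_SO_le flow_solutionD(1)[OF \<theta>] in auto)
      then show ?thesis
        using init by (simp add: dist_norm power2_le_iff_abs_le)
    qed
    have "?y t \<le> exp (- 1 * t) * ?y 0"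
    proof (rule gronwall_halfline[OF trace_flow_norm_square_derivative[OF \<theta>] _ \<open>t \<ge> 0\<close>])
      fix t :: real assume "t \<ge> 0"
      let ?E = "\<theta> t - mat 1"
      note \<theta>t = flow_solutionD(1)[OF \<theta> \<open>t \<ge> 0\<close>]
      have "trace_flow (\<theta> t) = (- 1/2) *\<^sub>R (2 *\<^sub>R ?E + ?E ** ?E)"
        by (simp add: trace_flow_def matrix_mult_distribs scaleR_2 scaleR_right_diff_distrib)
      then have "?E \<bullet> trace_flow (\<theta> t) = (- 1/2) * (2 * (?E \<bullet> ?E) + ?E \<bullet> (?E ** ?E))"
        by (simp only: inner_scaleR_right inner_add_right)
      then have "2 * (?E \<bullet> trace_flow (\<theta> t)) = - (2 * ?y t + ?E \<bullet> (?E ** ?E))"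
        by (simp add: power2_norm_eq_inner field_simps)
      then have "- ?d t = - (2 * ?y t + ?E \<bullet> (?E ** ?E))"
        by (simp only: inner_trace_flow[OF \<theta>t])
      moreover have "\<bar>?E \<bullet> (?E ** ?E)\<bar> \<le> ?y t"
      proof -
        have "\<bar>?E \<bullet> (?E ** ?E)\<bar> \<le> norm ?E * norm (?E ** ?E)"
          by (rule Cauchy_Schwarz_ineq2)
        also have "\<dots> \<le> norm ?E * (norm ?E * (norm ?E * K))"
          using K[rule_format, of ?E ?E] by (intro mult_left_mono) (auto simp: mult.assoc)
        also have "\<dots> \<le> norm ?E * (norm ?E * 1)"
          using small[OF \<open>t \<ge> 0\<close>] \<open>K > 0\<close> by (intro mult_left_mono) (auto simp: field_simps)
        finally show ?thesis
          by (simp add: power2_eq_square)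
      qed
      ultimately show "- ?d t \<le> - 1 * ?y t"
        by linarith
    qed
    also have "\<dots> = (exp (- (1/2) * t) * norm (\<theta> 0 - mat 1))\<^sup>2"
      by (simp add: power_mult_distrib flip: exp_double)
    finally show ?thesis
      by (simp add: dist_norm power2_le_iff_abs_le)
  qed
  show ?thesis
    unfolding locally_exponentially_stable_def
    by (rule exI[of _ "1 / K"], rule conjI, use \<open>K > 0\<close> in simp,
        rule exI[of _ 1], rule conjI, simp, rule exI[of _ "1/2"]) (use decay in auto)
qed

section \<open>Smoothness of rational matrix functions\<close>

lemma frechet_derivative_cong_open:
  assumes "open W" "x \<in> W" "\<And>y. y \<in> W \<Longrightarrow> f y = g y"
  shows "frechet_derivative f (at x) = frechet_derivative g (at x)"
proof -
  have "(f has_derivative D) (at x) \<longleftrightarrow> (g has_derivative D) (at x)" for D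
    using has_derivative_transform_within_open[of f D x UNIV W g]
      has_derivative_transform_within_open[of g D x UNIV W f] assms by auto
  then show ?thesis
    by (simp add: frechet_derivative_def)
qed

lemma Ck_on_cong_open:
  assumes "open W" "\<And>x. x \<in> W \<Longrightarrow> f x = g x" "Ck_on k W f"
  shows "Ck_on k W g"
  using assms(2,3)
proof (induction k arbitrary: f g)
  case 0
  then show ?case
    by (simp cong: continuous_on_cong)
next
  case (Suc k)
  have "g differentiable at x" if "x \<in> W" for x
  proof -
    obtain D where "(f has_derivative D) (at x)"
      using Suc.prems(2) \<open>x \<in> W\<close> by (auto simp: differentiable_def)
    then have "(g has_derivative D) (at x)"
      using has_derivative_transform_within_open[of f D x UNIV W g] Suc.prems(1) \<open>x \<in> W\<close> \<open>open W\<close>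
      by simp
    then show ?thesis
      by (auto simp: differentiable_def)
  qed
  moreover have "Ck_on k W (\<lambda>x. frechet_derivative g (at x) v)" for v
  proof (rule Suc.IH)
    show "Ck_on k W (\<lambda>x. frechet_derivative f (at x) v)"
      using Suc.prems by simp
    show "frechet_derivative f (at x) v = frechet_derivative g (at x) v" if "x \<in> W" for x
      using frechet_derivative_cong_open[OF \<open>open W\<close> that, of f g] Suc.prems(1) by simp
  qed
  ultimately show ?case by simp
qed

text \<open>Allows an explicit derivative in place of the chosen
  \<open>frechet_derivative\<close>.\<close>

lemma Ck_on_SucI:
  assumes "open W" "\<And>x. x \<in> W \<Longrightarrow> (f has_derivative D x) (at x)" "\<And>v. Ck_on k W (\<lambda>x. D x v)"
  shows "Ck_on (Suc k) W f"
proof -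
  have "Ck_on k W (\<lambda>x. frechet_derivative f (at x) v)" for v
    by (rule Ck_on_cong_open[OF \<open>open W\<close> _ assms(3)]) (use frechet_derivative_at[OF assms(2)] in simp)
  moreover have "f differentiable at x" if "x \<in> W" for x
    using assms(2)[OF that] differentiable_def by blast
  ultimately show ?thesis by simp
qed

text \<open>Closure under directional derivatives yields all orders at once, bypassing product and
  chain rules for \<open>Ck_on\<close>. The quantifier over \<open>v\<close> sits below
  \<open>x \<in> W\<close>, so a point of \<open>W\<close> is required to use it.\<close>

lemma Ck_on_closed_class:
  fixes C :: "('a::euclidean_space \<Rightarrow> 'b::real_normed_vector) set"
  assumes W: "open W" and "f \<in> C"
    and closed: "\<And>f. f \<in> C \<Longrightarrow> \<exists>D. \<forall>x\<in>W. (f has_derivative D x) (at x) \<and> (\<forall>v. (\<lambda>x. D x v) \<in> C)"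
    and "W \<noteq> {}"
  shows "Ck_on k W f"
  using \<open>f \<in> C\<close>
proof (induction k arbitrary: f)
  case 0
  from closed[OF this] show ?case
    by (auto intro!: continuous_at_imp_continuous_on dest!: has_derivative_continuous)
next
  case (Suc k)
  from closed[OF Suc.prems] obtain D
    where D: "\<And>x. x \<in> W \<Longrightarrow> (f has_derivative D x) (at x)" "\<And>v. (\<lambda>x. D x v) \<in> C"
    using \<open>W \<noteq> {}\<close> by blast
  show ?case
    by (rule Ck_on_SucI[OF W D(1) Suc.IH[OF D(2)]])
qed

text \<open>Passes from matrix-valued functions to their entries, which are the chart
  coordinates.\<close>

lemma Ck_on_bounded_linear:
  assumes W: "open W" and L: "bounded_linear L" and "Ck_on k W f"
  shows "Ck_on k W (\<lambda>x. L (f x))"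
  using assms(3)
proof (induction k arbitrary: f)
  case 0
  then show ?case
    using bounded_linear.continuous_on[OF L] by simp
next
  case (Suc k)
  show ?case
  proof (rule Ck_on_SucI[OF W])
    show "((\<lambda>x. L (f x)) has_derivative (\<lambda>v. L (frechet_derivative f (at x) v))) (at x)" if "x \<in> W" for x
      using Suc.prems that by (intro bounded_linear.has_derivative[OF L]) (simp add: frechet_derivative_works)
    show "Ck_on k W (\<lambda>x. L (frechet_derivative f (at x) v))" for v
      using Suc by simp
  qed
qed

text \<open>A class closed under directional derivatives: differentiating an inverse yields products
  of the same inverse with a derivative. Scalars and signs are represented by constant matrix
  factors.\<close>

inductive matrix_rational :: "(real^'n^'n) set \<Rightarrow> (real^'n^'n \<Rightarrow> real^'n^'n) \<Rightarrow> bool" for W where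
  const: "matrix_rational W (\<lambda>x. c)"
| ident: "matrix_rational W (\<lambda>x. x)"
| add: "matrix_rational W f \<Longrightarrow> matrix_rational W g \<Longrightarrow> matrix_rational W (\<lambda>x. f x + g x)"
| mult: "matrix_rational W f \<Longrightarrow> matrix_rational W g \<Longrightarrow> matrix_rational W (\<lambda>x. f x ** g x)"
| inv: "matrix_rational W f \<Longrightarrow> (\<And>x. x \<in> W \<Longrightarrow> det (f x) \<noteq> 0) \<Longrightarrow> matrix_rational W (\<lambda>x. matrix_inv (f x))"

lemma matrix_rational_derivative:
  assumes "matrix_rational W f"
  shows "\<exists>D. \<forall>x\<in>W. (f has_derivative D x) (at x) \<and> (\<forall>v. matrix_rational W (\<lambda>x. D x v))"
proof -
  have "\<exists>D. (\<forall>x\<in>W. (f has_derivative D x) (at x)) \<and> (\<forall>v. matrix_rational W (\<lambda>x. D x v))"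
    using assms
  proof induction
    case (const c)
    show ?case
      by (rule exI[of _ "\<lambda>x v. 0"]) (auto intro: matrix_rational.intros)
  next
    case ident
    show ?case
      by (rule exI[of _ "\<lambda>x v. v"]) (auto intro: matrix_rational.intros)
  next
    case (add f g)
    then obtain D E where
      "\<forall>x\<in>W. (f has_derivative D x) (at x)" "\<forall>v. matrix_rational W (\<lambda>x. D x v)"
      "\<forall>x\<in>W. (g has_derivative E x) (at x)" "\<forall>v. matrix_rational W (\<lambda>x. E x v)" by blast
    then show ?case
      by (intro exI[of _ "\<lambda>x v. D x v + E x v"])
        (auto intro: matrix_rational.intros has_derivative_add)
  next
    case (mult f g)
    then obtain D E where
      "\<forall>x\<in>W. (f has_derivative D x) (at x)" "\<forall>v. matrix_rational W (\<lambda>x. D x v)"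
      "\<forall>x\<in>W. (g has_derivative E x) (at x)" "\<forall>v. matrix_rational W (\<lambda>x. E x v)" by blast
    then show ?case
      using mult.hyps
      by (intro exI[of _ "\<lambda>x v. f x ** E x v + D x v ** g x"] conjI ballI allI
          matrix_rational.add matrix_rational.mult bounded_bilinear.FDERIV[OF bounded_bilinear_matrix_mult])
        auto
  next
    case (inv f)
    then obtain D where
      D: "\<forall>x\<in>W. (f has_derivative D x) (at x)" "\<forall>v. matrix_rational W (\<lambda>x. D x v)" by blast
    have "((\<lambda>x. matrix_inv (f x)) has_derivative
        (\<lambda>v. (- mat 1) ** (matrix_inv (f x) ** D x v ** matrix_inv (f x)))) (at x)" if "x \<in> W" for x
      using has_derivative_compose[of f "D x" x UNIV matrix_inv, OF _ has_derivative_matrix_inv[OF inv.hyps(2)[OF that]]] D(1) that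
      by (simp add: matrix_mult_distribs)
    moreover have "matrix_rational W (\<lambda>x. (- mat 1) ** (matrix_inv (f x) ** D x v ** matrix_inv (f x)))" for v
      using D(2) inv.hyps by (intro matrix_rational.intros) auto
    ultimately show ?case
      by (intro exI[of _ "\<lambda>x v. (- mat 1) ** (matrix_inv (f x) ** D x v ** matrix_inv (f x))"]) auto
  qed
  then show ?thesis by blast
qed

lemma matrix_rational_Ck_on:
  assumes "open W" "matrix_rational W f"
  shows "Ck_on k W f"
\<comment> \<open>On the empty set \<open>Ck_on\<close> holds vacuously at every order.\<close>
proof (cases "W = {}")
  case True
  then show ?thesis
    by (induction k arbitrary: f) auto
next
  case False
  then show ?thesis
    using assms matrix_rational_derivative
    by (intro Ck_on_closed_class[of W f "Collect (matrix_rational W)"]) auto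
qed

text \<open>\<open>P\<close> is affine in each coordinate, so the \<open>i\<close>-th partial
  derivative of \<open>g\<close> after \<open>P\<close> is the derivative of \<open>g\<close> in the
  fixed direction \<open>E i\<close>, again composed with \<open>P\<close>. This preserves the shape
  and permits induction on \<open>k\<close>.\<close>

lemma Ck_coord_affine_compose:
  fixes P :: "(nat \<Rightarrow> real) \<Rightarrow> 'a::euclidean_space" and g :: "'a \<Rightarrow> 'b::real_normed_vector"
  assumes W: "open W"
    and V: "\<And>x i t. x \<in> V \<Longrightarrow> i < m \<Longrightarrow> x(i := t) \<in> V"
    and PW: "\<And>x. x \<in> V \<Longrightarrow> P x \<in> W"
    and cont: "continuous_map (subtopology (powertop_real {..<m}) V) euclidean P"
    and upd: "\<And>x i t. x \<in> V \<Longrightarrow> i < m \<Longrightarrow> P (x(i := t)) = P x + (t - x i) *\<^sub>R E i"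
    and h: "\<And>x. x \<in> V \<Longrightarrow> h x = g (P x)"
    and "Ck_on k W g"
  shows "Ck_coord m k V h"
  using h assms(7)
proof (induction k arbitrary: g h)
  have continuous: "continuous_map (subtopology (powertop_real {..<m}) V) euclidean h"
    if "continuous_on W g" and h: "\<And>x. x \<in> V \<Longrightarrow> h x = g (P x)" for g h :: "_ \<Rightarrow> 'b"
  proof -
    have "continuous_map (subtopology (powertop_real {..<m}) V) (top_of_set W) P"
      using cont PW by (auto simp: continuous_map_in_subtopology)
    then have "continuous_map (subtopology (powertop_real {..<m}) V) euclidean (g \<circ> P)"
      using \<open>continuous_on W g\<close> by (intro continuous_map_compose) auto
    then show ?thesis
      by (rule continuous_map_eq) (use h in auto)
  qed
  {
    case 0
    then show ?case
      using continuous by simp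
  next
    case (Suc k)
    have deriv: "((\<lambda>t. h (x(i := t))) has_vector_derivative frechet_derivative g (at (P x)) (E i)) (at (x i))"
      if "x \<in> V" "i < m" for x i
    proof -
      have *: "h (x(i := t)) = g (P x + (t - x i) *\<^sub>R E i)" for t
        by (simp only: Suc.prems(1)[OF V[OF that]] upd[OF that])
      have "((\<lambda>t. P x + (t - x i) *\<^sub>R E i) has_derivative (\<lambda>t. t *\<^sub>R E i)) (at (x i))"
        by (auto intro!: derivative_eq_intros)
      moreover have "(g has_derivative frechet_derivative g (at (P x))) (at (P x + (x i - x i) *\<^sub>R E i))"
        using Suc.prems(2) PW[OF \<open>x \<in> V\<close>] by (simp add: frechet_derivative_works)
      ultimately have "((\<lambda>t. g (P x + (t - x i) *\<^sub>R E i)) has_derivative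
          (\<lambda>t. frechet_derivative g (at (P x)) (t *\<^sub>R E i))) (at (x i))"
        by (rule has_derivative_compose)
      moreover have "linear (frechet_derivative g (at (P x)))"
        using Suc.prems(2) PW[OF \<open>x \<in> V\<close>] by (simp add: linear_frechet_derivative)
      ultimately show ?thesis
        unfolding has_vector_derivative_def * by (simp add: linear_cmul)
    qed
    have "continuous_on W g"
      using Suc.prems(2)
      by (auto intro!: continuous_at_imp_continuous_on differentiable_imp_continuous_within)
    then have "continuous_map (subtopology (powertop_real {..<m}) V) euclidean h"
      using continuous Suc.prems(1) by blast
    moreover have "(\<lambda>t. h (x(i := t))) differentiable at (x i)" if "x \<in> V" "i < m" for x i
      using deriv[OF that] by (auto simp: has_vector_derivative_def differentiable_def)
    moreover have "Ck_coord m k V (\<lambda>x. vector_derivative (\<lambda>t. h (x(i := t))) (at (x i)))" if "i < m" for i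
    proof (rule Suc.IH)
      show "Ck_on k W (\<lambda>y. frechet_derivative g (at y) (E i))"
        using Suc.prems(2) by simp
      show "vector_derivative (\<lambda>t. h (x(i := t))) (at (x i)) = frechet_derivative g (at (P x)) (E i)"
        if "x \<in> V" for x
        by (rule vector_derivative_at[OF deriv[OF that \<open>i < m\<close>]])
    qed
    ultimately show ?case by simp
  }
qed

section \<open>Zero sets of polynomials\<close>

text \<open>Fubini, one coordinate at a time: by induction almost every line in direction
  \<open>k\<close> carries a nonzero value of \<open>g\<close>, hence has only finitely many
  zeros.\<close>

lemma zero_set_null_Pi_lborel:
  fixes g :: "(nat \<Rightarrow> real) \<Rightarrow> real"
  assumes "finite I"
    and "g \<in> borel_measurable (Pi\<^sub>M I (\<lambda>_. lborel))"
    and "\<And>x i. i \<in> I \<Longrightarrow> finite {t. g (x(i := t)) = 0} \<or> (\<forall>t. g (x(i := t)) = 0)"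
    and "x0 \<in> PiE I (\<lambda>_. UNIV)" "g x0 \<noteq> 0"
  shows "{x \<in> PiE I (\<lambda>_. UNIV). g x = 0} \<in> null_sets (Pi\<^sub>M I (\<lambda>_. lborel))"
  using assms
proof (induction I arbitrary: g x0)
  case empty
  then have *: "{x \<in> PiE {} (\<lambda>_. UNIV). g x = 0} = {}"
    by auto
  show ?case
    unfolding * by (simp add: null_sets_def)
next
  case (insert k I)
  interpret product_sigma_finite "\<lambda>_::nat. lborel :: real measure" ..
  let ?M = "\<lambda>I. Pi\<^sub>M I (\<lambda>_::nat. lborel :: real measure)"
  have space: "space (?M J) = PiE J (\<lambda>_. UNIV)" for J
    by (simp add: space_PiM)
  note [measurable] = insert.prems(1)
  \<comment> \<open>The last coordinate is frozen at its value in the witness \<open>x0\<close>, so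
    that \<open>?g\<close> again has a nonzero value.\<close>
  let ?g = "\<lambda>y. g (y(k := x0 k))"
  have upd [measurable]: "(\<lambda>y. y(k := c)) \<in> measurable (?M I) (?M (insert k I))" for c
    by (rule measurable_fun_upd[of _ I]) auto
  have N: "{y \<in> PiE I (\<lambda>_. UNIV). ?g y = 0} \<in> null_sets (?M I)"
  proof (rule insert.IH)
    show "?g \<in> borel_measurable (?M I)" by measurable
    show "finite {t. ?g (x(i := t)) = 0} \<or> (\<forall>t. ?g (x(i := t)) = 0)" if "i \<in> I" for x i
    proof -
      have "x(i := t, k := x0 k) = x(k := x0 k, i := t)" for t
        using insert.hyps that by (intro fun_upd_twist) auto
      then show ?thesis
        using insert.prems(2)[OF insertI2[OF that], of "x(k := x0 k)"] by (simp only:)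
    qed
    \<comment> \<open>Resetting coordinate \<open>k\<close> makes the witness extensional on
      \<open>I\<close>; \<open>?g\<close> overwrites that coordinate anyway.\<close>
    show "x0(k := undefined) \<in> PiE I (\<lambda>_. UNIV)"
      using insert.prems(3) insert.hyps by (auto simp: PiE_iff extensional_def)
    show "?g (x0(k := undefined)) \<noteq> 0"
      using insert.prems(4) by simp
  qed
  let ?Z = "{x \<in> PiE (insert k I) (\<lambda>_. UNIV). g x = 0}"
  have Z: "?Z \<in> sets (?M (insert k I))"
    unfolding space[symmetric] by measurable
  have "emeasure (?M (insert k I)) ?Z = (\<integral>\<^sup>+ x. indicator ?Z x \<partial>?M (insert k I))"
    using Z by simp
  also have "\<dots> = (\<integral>\<^sup>+ y. (\<integral>\<^sup>+ t. indicator ?Z (y(k := t)) \<partial>lborel) \<partial>?M I)"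
    using Z insert.hyps by (intro product_nn_integral_insert) auto
  also have "\<dots> = (\<integral>\<^sup>+ y. 0 \<partial>?M I)"
  proof (rule nn_integral_cong_AE)
    have slice: "(\<integral>\<^sup>+ t. indicator ?Z (y(k := t)) \<partial>lborel) = 0" if "?g y \<noteq> 0" for y
    proof -
      have "finite {t. g (y(k := t)) = 0}"
        using insert.prems(2)[OF insertI1, of y] that by blast
      then have "AE t in lborel. t \<notin> {t. g (y(k := t)) = 0}"
        by (intro AE_not_in finite_imp_null_set_lborel)
      then have "AE t in lborel. indicator ?Z (y(k := t)) = (0 :: ennreal)"
        by eventually_elim (auto simp: indicator_def)
      then show ?thesis
        by (subst nn_integral_cong_AE) auto
    qed
    show "AE y in ?M I. (\<integral>\<^sup>+ t. indicator ?Z (y(k := t)) \<partial>lborel) = 0"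
    proof (rule AE_mp[OF AE_not_in[OF N]], rule AE_I2, rule impI)
      fix y assume "y \<in> space (?M I)" "y \<notin> {y \<in> PiE I (\<lambda>_. UNIV). ?g y = 0}"
      then show "(\<integral>\<^sup>+ t. indicator ?Z (y(k := t)) \<partial>lborel) = 0"
        by (intro slice) (simp add: space)
    qed
  qed
  finally show ?case
    using Z by (auto simp: null_sets_def)
qed

lemma finite_zeros_of_real_polynomial_function:
  fixes q :: "real \<Rightarrow> real"
  assumes "real_polynomial_function q"
  shows "finite {t. q t = 0} \<or> (\<forall>t. q t = 0)"
proof -
  obtain a n where q: "q = (\<lambda>x. \<Sum>i\<le>n. a i * x ^ i)"
    using assms real_polynomial_function_iff_sum by blast
  show ?thesis
  proof (cases "\<exists>k\<le>n. a k \<noteq> 0")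
    case True
    then show ?thesis
      unfolding q using polyfun_finite_roots[of a n] by blast
  qed (auto simp: q)
qed

lemma real_polynomial_function_det_affine:
  fixes A B :: "real^'n^'n"
  shows "real_polynomial_function (\<lambda>t::real. det (A + t *\<^sub>R B))"
proof -
  have "real_polynomial_function (\<lambda>t::real. (A + t *\<^sub>R B) $ i $ j)" for i j
    using real_polynomial_function.intros(1)[OF bounded_linear_ident]
    by (simp add: real_polynomial_function.intros(2-4))
  then show ?thesis
    unfolding det_def
    by (intro real_polynomial_function_sum real_polynomial_function.intros(2,4)
        real_polynomial_function_prod) auto
qed

lemma finite_zeros_det_affine:
  "finite {t::real. det (A + t *\<^sub>R B) = 0} \<or> (\<forall>t::real. det (A + t *\<^sub>R B) = 0)"
  for A B :: "real^'n^'n"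
  by (rule finite_zeros_of_real_polynomial_function[OF real_polynomial_function_det_affine])

section \<open>Sign matrices and coordinates of skew-symmetric matrices\<close>

definition sign_matrix :: "'n set \<Rightarrow> real^'n^'n" where
  "sign_matrix K = (\<chi> i j. if i = j then (if i \<in> K then -1 else 1) else 0)"

lemma sign_matrix_vector_mult: "(sign_matrix K *v x) $ i = (if i \<in> K then - x $ i else x $ i)"
proof -
  have "(sign_matrix K *v x) $ i = (\<Sum>j\<in>UNIV. if i = j then (if i \<in> K then - x $ j else x $ j) else 0)"
    unfolding sign_matrix_def matrix_vector_mult_def by (simp only: vec_lambda_beta, intro sum.cong) auto
  then show ?thesis by simp
qed

lemma transpose_sign_matrix: "transpose (sign_matrix K) = sign_matrix K"
  by (auto simp: sign_matrix_def transpose_def vec_eq_iff)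

lemma sign_matrix_square: "sign_matrix K ** sign_matrix K = mat 1"
  by (simp add: matrix_eq vec_eq_iff sign_matrix_vector_mult flip: matrix_vector_mul_assoc)

lemma det_sign_matrix: "det (sign_matrix K) = (-1) ^ card K"
proof -
  have "det (sign_matrix K) = (\<Prod>i\<in>UNIV. if i \<in> K then -1 else 1)"
    by (subst det_diagonal) (simp_all add: sign_matrix_def)
  also have "\<dots> = (\<Prod>i\<in>K. -1)"
    by (rule prod.mono_neutral_cong_right) auto
  finally show ?thesis by simp
qed

text \<open>Flipping the sign in row \<open>k\<close> changes the determinant by twice the determinant of the matrix
  whose \<open>k\<close>-th row is replaced by a unit vector, so one of the two signs keeps it nonzero.\<close>

lemma exists_det_sign_matrix_add_nonzero:
  fixes A :: "real^'n^'n"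
  shows "\<exists>K. det (sign_matrix K + A) \<noteq> 0"
proof -
  have "\<exists>K. det (\<chi> i. if i \<in> J then (sign_matrix K + A) $ i else axis i 1) \<noteq> 0" for J :: "'n set"
    using finite[of J]
  proof (induction J rule: finite_induct)
    case empty
    have "(\<chi> i. axis i 1) = (mat 1 :: real^'n^'n)"
      by (auto simp: vec_eq_iff mat_def axis_def)
    then show ?case by simp
  next
    case (insert k J)
    then obtain K where K: "det (\<chi> i. if i \<in> J then (sign_matrix K + A) $ i else axis i 1) \<noteq> 0"
      by blast
    define c where "c i = (if i \<in> J then (sign_matrix K + A) $ i else axis i 1)" for i
    define N where "N a = det (\<chi> i. if i = k then a else c i)" for a
    have add: "N (a + b) = N a + N b" for a b
      unfolding N_def by (rule det_row_add)
    have "(\<chi> i. if i = k then axis k 1 else c i) = (\<chi> i. c i)"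
      using insert.hyps by (auto simp: vec_eq_iff c_def)
    then have "N (axis k 1) \<noteq> 0"
      using K by (simp add: N_def c_def)
    moreover have "N (A $ k + axis k 1) = N (A $ k - axis k 1) + N (axis k 1) + N (axis k 1)"
      by (simp flip: add)
    ultimately have "N (A $ k + axis k 1) \<noteq> 0 \<or> N (A $ k - axis k 1) \<noteq> 0"
      by linarith
    moreover have "N (A $ k + axis k 1)
        = det (\<chi> i. if i \<in> insert k J then (sign_matrix (K - {k}) + A) $ i else axis i 1)"
      unfolding N_def using insert.hyps
      by (intro arg_cong[where f = det]) (auto simp: vec_eq_iff c_def sign_matrix_def axis_def)
    moreover have "N (A $ k - axis k 1)
        = det (\<chi> i. if i \<in> insert k J then (sign_matrix (insert k K) + A) $ i else axis i 1)"
      unfolding N_def using insert.hyps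
      by (intro arg_cong[where f = det]) (auto simp: vec_eq_iff c_def sign_matrix_def axis_def)
    ultimately show ?case by metis
  qed
  from this[of UNIV] show ?thesis
    by (simp only: UNIV_I if_True vec_lambda_eta)
qed

text \<open>Orthogonal matrices of opposite determinant have a singular sum, by determinants in
  \<open>A^T (A + B) B^T = (A + B)^T\<close>. So a sign matrix whose sum with a rotation is
  invertible is itself a rotation.\<close>

lemma det_orthogonal_add_nonzero:
  fixes A B :: "real^'n^'n"
  assumes "transpose A ** A = mat 1" "B \<in> SO" "det (A + B) \<noteq> 0"
  shows "det A = 1"
proof -
  have "transpose A ** (A + B) ** transpose B = transpose (A + B)"
    using SO_orthogonal[OF \<open>B \<in> SO\<close>]
    by (simp add: matrix_mult_distribs assms(1) transpose_linear flip: matrix_mul_assoc)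
  then have "det A * det (A + B) * det B = det (A + B)"
    by (metis det_mul det_transpose)
  then show ?thesis
    using assms(2,3) by (simp add: SO_def rotation_matrix_def)
qed

text \<open>An oriented perfect matching of \<open>K\<close>: the sign condition rules out fixed
  points of \<open>\<sigma>\<close>. It encodes an invertible skew-symmetric matrix with 2 by 2
  blocks, and is built by splitting off two elements at a time.\<close>

lemma finite_even_signed_pairing:
  assumes "finite K" "even (card K)"
  shows "\<exists>(\<sigma> :: 'a \<Rightarrow> 'a) (s :: 'a \<Rightarrow> real).
    \<forall>i\<in>K. \<sigma> i \<in> K \<and> \<sigma> (\<sigma> i) = i \<and> s i \<noteq> 0 \<and> s (\<sigma> i) = - s i"
  using assms
proof (induction K rule: finite_psubset_induct)
  case (psubset K)
  show ?case
  proof (cases "K = {}")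
    case False
    then obtain a where a: "a \<in> K" by blast
    then have "card K = Suc (card (K - {a}))"
      using psubset.hyps by (simp only: card_Suc_Diff1)
    then have "K - {a} \<noteq> {}"
      using psubset.prems by (intro notI) simp
    then obtain b where b: "b \<in> K" "b \<noteq> a"
      by blast
    have "card (K - {a, b}) = card K - card {a, b}"
      using a b by (intro card_Diff_subset) auto
    moreover have "card {a, b} \<le> card K"
      using a b psubset.hyps by (intro card_mono) auto
    moreover have "card {a, b} = 2"
      using b by simp
    ultimately have "card K = card (K - {a, b}) + 2"
      by linarith
    then have "even (card (K - {a, b}))"
      using psubset.prems by simp
    moreover have "K - {a, b} \<subset> K"
      using a by blast
    ultimately obtain \<sigma> s where
      *: "\<forall>i\<in>K - {a, b}. \<sigma> i \<in> K - {a, b} \<and> \<sigma> (\<sigma> i) = i \<and> s i \<noteq> (0::real) \<and> s (\<sigma> i) = - s i"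
      using psubset.IH by blast
    show ?thesis
      by (rule exI[of _ "\<sigma>(a := b, b := a)"], rule exI[of _ "s(a := 1, b := -1)"])
        (use * a b in auto)
  qed auto
qed

text \<open>Rows outside \<open>K\<close> are those of \<open>2 I\<close>, rows in \<open>K\<close>
  those of \<open>2 A\<close>. The matching makes \<open>A\<close> a signed permutation of the
  coordinates in \<open>K\<close>.\<close>

lemma exists_skew_det_nonzero:
  assumes "even (card K)"
  shows "\<exists>A :: real^'n^'n. skew_symmetric A \<and>
    det ((mat 1 + sign_matrix K) + (mat 1 - sign_matrix K) ** A) \<noteq> 0"
proof -
  obtain \<sigma> s where \<sigma>: "\<And>i. i \<in> K \<Longrightarrow> \<sigma> i \<in> K \<and> \<sigma> (\<sigma> i) = i \<and> s i \<noteq> (0::real) \<and> s (\<sigma> i) = - s i"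
    using finite_even_signed_pairing[OF finite assms] by blast
  define A :: "real^'n^'n" where "A = (\<chi> i j. if i \<in> K \<and> j = \<sigma> i then s i else 0)"
  have "skew_symmetric A"
    unfolding skew_symmetric_def vec_eq_iff A_def transpose_def using \<sigma> by auto
  moreover have "det ((mat 1 + sign_matrix K) + (mat 1 - sign_matrix K) ** A) \<noteq> 0"
    unfolding det_nonzero_iff_ker
  proof (intro allI impI)
    fix x assume "((mat 1 + sign_matrix K) + (mat 1 - sign_matrix K) ** A) *v x = 0"
    then have x: "(x + sign_matrix K *v x + (A *v x - sign_matrix K *v (A *v x))) $ i = 0" for i
      by (simp add: matrix_vector_mult_add_rdistrib matrix_vector_mult_diff_rdistrib
          flip: matrix_vector_mul_assoc)
    have Ax: "(A *v x) $ i = s i * x $ \<sigma> i" if "i \<in> K" for i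
    proof -
      have "(A *v x) $ i = (\<Sum>j\<in>UNIV. if j = \<sigma> i then s i * x $ j else 0)"
        unfolding A_def matrix_vector_mult_def using that by (simp only: vec_lambda_beta, intro sum.cong) auto
      then show ?thesis by simp
    qed
    have "x $ i = 0" if "i \<notin> K" for i
      using x[of i] that by (simp add: sign_matrix_vector_mult)
    moreover have "x $ i = 0" if "i \<in> K" for i
      \<comment> \<open>Row \<open>\<sigma> i\<close> is the one that sees \<open>x $ i\<close>,
        since \<open>\<sigma>\<close> is an involution.\<close>
      using x[of "\<sigma> i"] \<sigma>[OF that] Ax[of "\<sigma> i"] by (simp add: sign_matrix_vector_mult)
    ultimately show "x = 0"
      by (auto simp: vec_eq_iff)
  qed
  ultimately show ?thesis by blast
qed

text \<open>The dimension of the skew-symmetric matrices. The injection \<open>h\<close> stands in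
  for a linear order on the index type; swapping pairs accounts for the lower triangle.\<close>

lemma card_ordered_pairs:
  fixes h :: "'n::finite \<Rightarrow> nat"
  assumes "inj h"
  shows "card {(i, j). h i < h j} = CARD('n) * (CARD('n) - 1) div 2"
proof -
  let ?T = "{(i, j). h i < h j}" and ?T' = "{(i, j). h j < h i}"
  have "bij_betw prod.swap ?T ?T'"
    by (rule bij_betw_byWitness[of _ prod.swap]) auto
  then have T': "card ?T' = card ?T"
    by (simp add: bij_betw_same_card)
  have "UNIV = ?T \<union> ?T' \<union> range (\<lambda>i. (i, i))"
    using assms by (auto simp: image_iff) (metis injD nat_neq_iff)
  then have "CARD('n \<times> 'n) = card (?T \<union> ?T' \<union> range (\<lambda>i. (i, i)))"
    by simp
  also have "\<dots> = card ?T + card ?T' + card (range (\<lambda>i::'n. (i, i)))"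
    by (subst card_Un_disjoint; (subst card_Un_disjoint)?) auto
  also have "card (range (\<lambda>i::'n. (i, i))) = CARD('n)"
    by (rule card_image) (auto intro: injI)
  finally have "CARD('n) * CARD('n) = 2 * card ?T + CARD('n)"
    using T' by simp
  then show ?thesis
    by (simp add: diff_mult_distrib2)
qed

text \<open>Here \<open>P\<close> builds a matrix from its coordinates, \<open>E i\<close> is its \<open>i\<close>-th basis matrix, and \<open>r i\<close>, \<open>c i\<close>
  are the row and column of the \<open>i\<close>-th free entry.\<close>

lemma skew_coordinates:
  fixes m :: nat
  assumes m: "m = CARD('n) * (CARD('n) - 1) div 2"
  obtains P :: "(nat \<Rightarrow> real) \<Rightarrow> real^'n^'n" and E :: "nat \<Rightarrow> real^'n^'n" and r c :: "nat \<Rightarrow> 'n"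
  where "\<And>x. skew_symmetric (P x)"
    and "\<And>x i t. i < m \<Longrightarrow> P (x(i := t)) = P x + (t - x i) *\<^sub>R E i"
    and "\<And>x i. i < m \<Longrightarrow> P x $ r i $ c i = x i"
    and "\<And>A x. skew_symmetric A \<Longrightarrow> (\<And>i. i < m \<Longrightarrow> x i = A $ r i $ c i) \<Longrightarrow> P x = A"
    and "\<And>i j. (\<exists>k<m. \<exists>s. \<forall>x. P x $ i $ j = s * x k) \<or> (\<forall>x. P x $ i $ j = 0)"
proof -
  obtain h :: "'n \<Rightarrow> nat" where h: "inj h"
    using finite_imp_inj_to_nat_seg[of "UNIV :: 'n set"] by auto
  let ?T = "{(i, j). h i < h j}"
  obtain e where e: "bij_betw e {..<m} ?T"
    using ex_bij_betw_nat_finite[of ?T] card_ordered_pairs[OF h] m by (auto simp: atLeast0LessThan)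
  define p where "p i j = inv_into {..<m} e (i, j)" for i j
  have p: "p i j < m" "e (p i j) = (i, j)" if "h i < h j" for i j
  proof -
    have "(i, j) \<in> e ` {..<m}"
      using e that by (auto simp: bij_betw_def)
    then show "p i j < m" "e (p i j) = (i, j)"
      unfolding p_def using inv_into_into[of "(i, j)" e "{..<m}"] f_inv_into_f[of "(i, j)" e "{..<m}"] by auto
  qed
  have e_lt: "h (fst (e k)) < h (snd (e k))" if "k < m" for k
    using e that by (auto simp: bij_betw_def)
  have p_e: "p (fst (e k)) (snd (e k)) = k" if "k < m" for k
    unfolding p_def using e that by (simp add: bij_betw_def)
  define P :: "(nat \<Rightarrow> real) \<Rightarrow> real^'n^'n" where
    "P x = (\<chi> i j. if h i < h j then x (p i j) else if h j < h i then - x (p j i) else 0)" for x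
  show ?thesis
  proof (rule that[of P "\<lambda>i. P (\<lambda>j. if j = i then 1 else 0)" "\<lambda>k. fst (e k)" "\<lambda>k. snd (e k)"])
    show "skew_symmetric (P x)" for x
      unfolding skew_symmetric_def by (auto simp: P_def transpose_def vec_eq_iff)
    show "P (x(i := t)) = P x + (t - x i) *\<^sub>R P (\<lambda>j. if j = i then 1 else 0)" for x i t
      by (auto simp: P_def vec_eq_iff)
    show "P x $ fst (e k) $ snd (e k) = x k" if "k < m" for x k
      using e_lt[OF that] p_e[OF that] by (simp add: P_def)
    show "P x = A" if A: "skew_symmetric A" and x: "\<And>k. k < m \<Longrightarrow> x k = A $ fst (e k) $ snd (e k)" for A x
    proof -
      have skew: "A $ i $ j = - A $ j $ i" for i j
        using A unfolding skew_symmetric_def transpose_def by (metis vec_lambda_beta vector_uminus_component)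
      have diag: "A $ i $ i = 0" for i
        using skew[of i i] by simp
      have "P x $ i $ j = A $ i $ j" for i j
      proof -
        consider "h i < h j" | "h j < h i" | "i = j"
          using h by (metis injD linorder_cases)
        then show ?thesis
          by cases (use x p skew[of i j] diag in \<open>auto simp: P_def\<close>)
      qed
      then show ?thesis
        by (simp add: vec_eq_iff)
    qed
    show "(\<exists>k<m. \<exists>s. \<forall>x. P x $ i $ j = s * x k) \<or> (\<forall>x. P x $ i $ j = 0)" for i j
    proof -
      consider "h i < h j" | "h j < h i" | "i = j"
        using h by (metis injD linorder_cases)
      then show ?thesis
      proof cases
        case 1
        then show ?thesis
          using p[OF 1] by (intro disjI1 exI[of _ "p i j"] conjI exI[of _ 1]) (auto simp: P_def)
      next
        case 2
        then show ?thesis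
          using p[OF 2] by (intro disjI1 exI[of _ "p j i"] conjI exI[of _ "-1"]) (auto simp: P_def)
      qed (simp add: P_def)
    qed
  qed
qed

section \<open>Cayley charts\<close>

lemma continuous_map_vec_vec:
  fixes P :: "'a \<Rightarrow> real^'n^'m"
  assumes "\<And>i j. continuous_map X euclideanreal (\<lambda>x. P x $ i $ j)"
  shows "continuous_map X euclidean P"
  unfolding continuous_map_atin limitin_canonical_iff
proof
  fix x assume "x \<in> topspace X"
  then have "((\<lambda>y. P y $ i $ j) \<longlongrightarrow> P x $ i $ j) (atin X x)" for i j
    using assms[of i j] unfolding continuous_map_atin limitin_canonical_iff by blast
  then show "(P \<longlongrightarrow> P x) (atin X x)"
    by (intro vec_tendstoI)
qed

text \<open>Clearing the denominator: \<open>(I + D cayley A) (I + A) = (I + D) + (I - D) A\<close>.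
  The condition becomes polynomial in the coordinates of \<open>A\<close>.\<close>

lemma det_one_plus_mult_cayley:
  fixes D A :: "real^'n^'n"
  assumes "det (mat 1 + A) \<noteq> 0"
  shows "det (mat 1 + D ** cayley A) = 0 \<longleftrightarrow> det ((mat 1 + D) + (mat 1 - D) ** A) = 0"
proof -
  let ?R = "matrix_inv (mat 1 + A)"
  have "((mat 1 + D) + (mat 1 - D) ** A) ** ?R
      = (2 *\<^sub>R D + (mat 1 - D) ** (mat 1 + A)) ** ?R"
    by (simp add: matrix_mult_distribs scaleR_2)
  also have "\<dots> = 2 *\<^sub>R D ** ?R + (mat 1 - D) ** ((mat 1 + A) ** ?R)"
    by (simp only: matrix_mult_distribs(1)[of "2 *\<^sub>R D"] matrix_mul_assoc)
  also have "\<dots> = 2 *\<^sub>R D ** ?R + (mat 1 - D)"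
    by (simp only: matrix_inv_inverse(1)[OF assms] matrix_mul_rid)
  also have "\<dots> = mat 1 + D ** cayley A"
    by (simp add: cayley_def matrix_mult_distribs)
  finally have "det ((mat 1 + D) + (mat 1 - D) ** A) * det ?R = det (mat 1 + D ** cayley A)"
    by (metis det_mul)
  then show ?thesis
    using det_matrix_inv[OF assms] by auto
qed

text \<open>\<open>mat 1 + A\<close> is invertible for every skew-symmetric \<open>A\<close>, so the
  inverse chart is defined on the whole coordinate space. As \<open>D\<close> is an involution,
  \<open>det (I + D \<Theta>)\<close> and \<open>det (D + \<Theta>)\<close> vanish together, and
  \<open>U\<close> is exactly where the transform of \<open>D \<Theta>\<close> is available.\<close>

lemma cayley_chart:
  fixes D :: "real^'n^'n"
  assumes D: "D ** D = mat 1" "D \<in> SO"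
    and P: "\<And>x. skew_symmetric (P x)"
      "\<And>x i t. i < m \<Longrightarrow> P (x(i := t)) = P x + (t - x i) *\<^sub>R E i"
      "\<And>x i. i < m \<Longrightarrow> P x $ r i $ c i = x i"
      "\<And>A x. skew_symmetric A \<Longrightarrow> (\<And>i. i < m \<Longrightarrow> x i = A $ r i $ c i) \<Longrightarrow> P x = A"
      "\<And>i j. (\<exists>k<m. \<exists>s. \<forall>x. P x $ i $ j = s * x k) \<or> (\<forall>x. P x $ i $ j = 0)"
  defines "U \<equiv> {\<Theta> \<in> SO. det (D + \<Theta>) \<noteq> 0}"
    and "\<phi> \<equiv> \<lambda>\<Theta>. \<lambda>i\<in>{..<m}. cayley (D ** \<Theta>) $ r i $ c i"
  shows "smooth_chart SO m U \<phi>"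
    and "\<And>\<Theta>. \<Theta> \<in> U \<Longrightarrow> \<phi> \<Theta> \<in> PiE {..<m} (\<lambda>_. UNIV) \<and> D ** cayley (P (\<phi> \<Theta>)) = \<Theta>"
proof -
  \<comment> \<open>The candidate inverse chart; left multiplication by \<open>D\<close> undoes
    itself.\<close>
  define \<psi> where "\<psi> x = D ** cayley (P x)" for x
  have det_D: "det D \<noteq> 0"
    using D(2) by (simp add: SO_def rotation_matrix_def)
  have det_shift: "det (mat 1 + D ** \<Theta>) = det D * det (D + \<Theta>)" for \<Theta> :: "real^'n^'n"
    by (simp add: matrix_mult_distribs D(1) flip: det_mul)
  have detU: "det (mat 1 + D ** \<Theta>) \<noteq> 0" if "\<Theta> \<in> U" for \<Theta>
    using that det_D by (simp add: det_shift U_def)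
  have P\<phi>: "P (\<phi> \<Theta>) = cayley (D ** \<Theta>)" if "\<Theta> \<in> U" for \<Theta>
  proof (rule P(4))
    show "skew_symmetric (cayley (D ** \<Theta>))"
      using that detU[OF that] by (intro skew_symmetric_cayley SO_mult D) (auto simp: U_def)
  qed (simp add: \<phi>_def)
  have \<psi>\<phi>: "\<psi> (\<phi> \<Theta>) = \<Theta>" if "\<Theta> \<in> U" for \<Theta>
    by (simp add: \<psi>_def P\<phi>[OF that] cayley_cayley[OF detU[OF that]] matrix_mul_assoc D(1))
  have D\<psi>: "D ** \<psi> x = cayley (P x)" for x
    by (simp add: \<psi>_def matrix_mul_assoc D(1))
  have \<psi>U: "\<psi> x \<in> U" for x
  proof -
    have "\<psi> x \<in> SO"
      unfolding \<psi>_def by (intro SO_mult D cayley_skew_in_SO P)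
    moreover have "det D * det (D + \<psi> x) \<noteq> 0"
      unfolding det_shift[symmetric] D\<psi> by (rule det_one_plus_cayley[OF det_one_plus_skew[OF P(1)]])
    ultimately show ?thesis
      by (simp add: U_def)
  qed
  have \<phi>\<psi>: "\<phi> (\<psi> x) = x" if "x \<in> PiE {..<m} (\<lambda>_. UNIV)" for x
  proof
    show "\<phi> (\<psi> x) i = x i" for i
      using that by (auto simp: \<phi>_def D\<psi> cayley_cayley[OF det_one_plus_skew[OF P(1)]] P(3) PiE_iff extensional_def)
  qed
  have \<phi>_PiE: "\<phi> \<Theta> \<in> PiE {..<m} (\<lambda>_. UNIV)" for \<Theta>
    by (simp add: \<phi>_def PiE_iff)
  have image: "\<phi> ` U = PiE {..<m} (\<lambda>_. UNIV)"
    using \<phi>\<psi> \<psi>U \<phi>_PiE by (auto simp: image_iff) metis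
  have inj: "inj_on \<phi> U"
    by (rule inj_on_inverseI[of _ \<psi>]) (rule \<psi>\<phi>)
  have inv: "inv_into U \<phi> x = \<psi> x" if "x \<in> PiE {..<m} (\<lambda>_. UNIV)" for x
    by (rule inv_into_f_eq[OF inj \<psi>U \<phi>\<psi>[OF that]])
  \<comment> \<open>An open set of the ambient matrix space on which the formula for the chart makes
    sense, as the local extension in \<open>smooth_on_subset\<close> demands.\<close>
  let ?W = "{\<Theta>. det (mat 1 + D ** \<Theta>) \<noteq> 0}"
  have W: "open ?W"
    by (intro open_det_nonzero continuous_on_add continuous_on_const
        linear_continuous_on[OF bounded_bilinear.bounded_linear_right[OF bounded_bilinear_matrix_mult]])
  have U: "U = SO \<inter> ?W"
    using det_D by (auto simp: U_def det_shift)
  have smooth: "smooth_on_subset U (\<lambda>\<Theta>. \<phi> \<Theta> i)" if "i < m" for i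
    unfolding smooth_on_subset_def
  proof
    fix \<Theta> assume "\<Theta> \<in> U"
    \<comment> \<open>The factor 2 and the subtraction of \<open>mat 1\<close> are recast with
      constant matrices to fit the generators of the class.\<close>
    have "matrix_rational ?W (\<lambda>\<Theta>. (2 *\<^sub>R mat 1) ** matrix_inv (mat 1 + D ** \<Theta>) + (- mat 1))"
      by (intro matrix_rational.intros) simp
    then have "Ck_on k ?W (\<lambda>\<Theta>. cayley (D ** \<Theta>))" for k
      unfolding cayley_def by (intro matrix_rational_Ck_on[OF W]) (simp add: matrix_mult_distribs)
    then have "Ck_on k ?W (\<lambda>\<Theta>. cayley (D ** \<Theta>) $ r i $ c i)" for k
      by (intro Ck_on_bounded_linear[OF W, of "\<lambda>A. A $ r i $ c i"]
          bounded_linear_compose[OF bounded_linear_vec_nth bounded_linear_vec_nth])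
    then show "\<exists>V g. open V \<and> \<Theta> \<in> V \<and> (\<forall>k. Ck_on k V g) \<and> (\<forall>y\<in>V \<inter> U. g y = \<phi> y i)"
      using W \<open>\<Theta> \<in> U\<close> U that
      by (intro exI[of _ ?W] exI[of _ "\<lambda>\<Theta>. cayley (D ** \<Theta>) $ r i $ c i"]) (auto simp: \<phi>_def)
  qed
  let ?W' = "{A::real^'n^'n. det (mat 1 + A) \<noteq> 0}"
  have W': "open ?W'"
    by (intro open_det_nonzero continuous_on_add continuous_on_const continuous_on_id)
  have "matrix_rational ?W' (\<lambda>A. D ** ((2 *\<^sub>R mat 1) ** matrix_inv (mat 1 + A) + (- mat 1)))"
    by (intro matrix_rational.intros) simp
  then have Ck_inv: "Ck_on k ?W' (\<lambda>A. D ** cayley A)" for k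
    unfolding cayley_def by (intro matrix_rational_Ck_on[OF W']) (simp add: matrix_mult_distribs)
  have cont_P: "continuous_map (powertop_real {..<m}) euclidean P"
  proof (rule continuous_map_vec_vec)
    fix i j
    consider k s where "k < m" "\<forall>x. P x $ i $ j = s * x k" | "\<forall>x. P x $ i $ j = 0"
      using P(5)[of i j] by blast
    then show "continuous_map (powertop_real {..<m}) euclideanreal (\<lambda>x. P x $ i $ j)"
    proof cases
      case 1
      then show ?thesis
        using continuous_map_product_projection[of k "{..<m}" "\<lambda>_. euclideanreal"]
        by (simp add: continuous_map_real_mult_left)
    qed simp
  qed
  have "Ck_coord m k (PiE {..<m} (\<lambda>_. UNIV)) (inv_into U \<phi>)" for k
  proof (rule Ck_coord_affine_compose[OF W' _ _ _ _ _ Ck_inv])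
    show "x(i := t) \<in> PiE {..<m} (\<lambda>_. UNIV)" if "x \<in> PiE {..<m} (\<lambda>_. UNIV)" "i < m" for x :: "nat \<Rightarrow> real" and i t
      using that by (auto simp: PiE_iff extensional_def)
    show "P x \<in> ?W'" for x
      using det_one_plus_skew[OF P(1)] by simp
    show "continuous_map (subtopology (powertop_real {..<m}) (PiE {..<m} (\<lambda>_. UNIV))) euclidean P"
      using cont_P by (rule continuous_map_from_subtopology)
    show "P (x(i := t)) = P x + (t - x i) *\<^sub>R E i" if "i < m" for x i t
      by (rule P(2)[OF that])
    show "inv_into U \<phi> x = D ** cayley (P x)" if "x \<in> PiE {..<m} (\<lambda>_. UNIV)" for x
      using inv[OF that] by (simp add: \<psi>_def)
  qed
  moreover have "openin (top_of_set SO) U"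
    unfolding U using W by (rule openin_open_Int)
  moreover have "openin (powertop_real {..<m}) (PiE {..<m} (\<lambda>_. UNIV))"
    using openin_topspace[of "powertop_real {..<m}"] by simp
  ultimately show "smooth_chart SO m U \<phi>"
    unfolding smooth_chart_def image using inj smooth by blast
  show "\<phi> \<Theta> \<in> PiE {..<m} (\<lambda>_. UNIV) \<and> D ** cayley (P (\<phi> \<Theta>)) = \<Theta>" if "\<Theta> \<in> U" for \<Theta>
    using \<phi>_PiE \<psi>\<phi>[OF that] by (simp add: \<psi>_def)
qed

text \<open>Cayley charts at rotational sign matrices cover \<open>SO\<close>. Evenness of
  \<open>K\<close> follows from \<open>det (sign_matrix K) = (-1) ^ card K\<close>.\<close>

lemma exists_sign_matrix_in_SO:
  fixes \<Theta> :: "real^'n^'n"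
  assumes "\<Theta> \<in> SO"
  obtains K where "det (sign_matrix K + \<Theta>) \<noteq> 0" "sign_matrix K \<in> SO" "even (card K)"
proof -
  obtain K where K: "det (sign_matrix K + \<Theta>) \<noteq> 0"
    using exists_det_sign_matrix_add_nonzero by blast
  have orth: "transpose (sign_matrix K) ** sign_matrix K = mat 1"
    by (simp add: transpose_sign_matrix sign_matrix_square)
  then have det: "det (sign_matrix K) = 1"
    by (rule det_orthogonal_add_nonzero[OF _ assms K])
  then have "sign_matrix K \<in> SO"
    using orth by (simp add: SO_def rotation_matrix_def orthogonal_matrix)
  moreover have "even (card K)"
    by (rule ccontr) (use det in \<open>simp add: det_sign_matrix\<close>)
  ultimately show ?thesis
    using that K by blast
qed

text \<open>In each chart the set lies in the zero set of \<open>?g\<close>. Along a coordinate line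
  \<open>?g\<close> is the determinant of an affine matrix function, hence a polynomial, and a
  skew-symmetric witness shows that it is not identically zero.\<close>

lemma det_one_plus_zero_measure_zero:
  "manifold_measure_zero SO (CARD('n) * (CARD('n) - 1) div 2)
    {\<Theta> \<in> SO. det (mat 1 + \<Theta> :: real^'n^'n) = 0}"
proof -
  define m where "m = CARD('n) * (CARD('n) - 1) div 2"
  obtain P :: "(nat \<Rightarrow> real) \<Rightarrow> real^'n^'n" and E r c where
    P: "\<And>x. skew_symmetric (P x)"
      "\<And>x i t. i < m \<Longrightarrow> P (x(i := t)) = P x + (t - x i) *\<^sub>R E i"
      "\<And>x i. i < m \<Longrightarrow> P x $ r i $ c i = x i"
      "\<And>A x. skew_symmetric A \<Longrightarrow> (\<And>i. i < m \<Longrightarrow> x i = A $ r i $ c i) \<Longrightarrow> P x = A"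
      "\<And>i j. (\<exists>k<m. \<exists>s. \<forall>x. P x $ i $ j = s * x k) \<or> (\<forall>x. P x $ i $ j = 0)"
    using skew_coordinates[OF m_def] by blast
  let ?bad = "{\<Theta> \<in> SO. det (mat 1 + \<Theta> :: real^'n^'n) = 0}"
  let ?V = "PiE {..<m} (\<lambda>_. UNIV) :: (nat \<Rightarrow> real) set"
  define U where "U K = {\<Theta> \<in> SO. det (sign_matrix K + \<Theta>) \<noteq> 0}" for K :: "'n set"
  define \<phi> where "\<phi> K \<Theta> = (\<lambda>i\<in>{..<m}. cayley (sign_matrix K ** \<Theta>) $ r i $ c i)" for K \<Theta>
  let ?C = "{(U K, \<phi> K) | K. sign_matrix K \<in> SO \<and> even (card K)}"
  have "smooth_chart SO m (U K) (\<phi> K)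
      \<and> \<phi> K ` (?bad \<inter> U K) \<in> null_sets (completion (Pi\<^sub>M {..<m} (\<lambda>_. lborel)))"
    if K: "sign_matrix K \<in> SO" "even (card K)" for K
  proof
    let ?D = "sign_matrix K :: real^'n^'n"
    note chart = cayley_chart[OF sign_matrix_square K(1) P, folded U_def \<phi>_def]
    show "smooth_chart SO m (U K) (\<phi> K)"
      by (rule chart(1))
    let ?g = "\<lambda>x. det ((mat 1 + ?D) + (mat 1 - ?D) ** P x)"
    obtain A where A: "skew_symmetric A" "det ((mat 1 + ?D) + (mat 1 - ?D) ** A) \<noteq> 0"
      using exists_skew_det_nonzero[OF K(2)] by blast
    have "{x \<in> ?V. ?g x = 0} \<in> null_sets (Pi\<^sub>M {..<m} (\<lambda>_. lborel))"
    proof (rule zero_set_null_Pi_lborel)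
      have [measurable]: "(\<lambda>x. P x $ i $ j) \<in> borel_measurable (Pi\<^sub>M {..<m} (\<lambda>_. lborel))" for i j
      proof -
        consider k s where "k < m" "\<forall>x. P x $ i $ j = s * x k" | "\<forall>x. P x $ i $ j = 0"
          using P(5)[of i j] by blast
        then show ?thesis
        proof cases
          case 1
          then have "(\<lambda>x. x k) \<in> borel_measurable (Pi\<^sub>M {..<m} (\<lambda>_. lborel :: real measure))"
            using measurable_component_singleton[of k "{..<m}" "\<lambda>_. lborel :: real measure"] by simp
          then show ?thesis
            using 1 by simp
        qed simp
      qed
      show "?g \<in> borel_measurable (Pi\<^sub>M {..<m} (\<lambda>_. lborel))"
        unfolding det_def by (simp add: matrix_matrix_mult_def)
      show "finite {t. ?g (x(i := t)) = 0} \<or> (\<forall>t. ?g (x(i := t)) = 0)" if "i \<in> {..<m}" for x i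
      proof -
        have "(mat 1 + ?D) + (mat 1 - ?D) ** P (x(i := t))
            = ((mat 1 + ?D) + (mat 1 - ?D) ** (P x - x i *\<^sub>R E i)) + t *\<^sub>R ((mat 1 - ?D) ** E i)" for t
          using that by (simp add: P(2) matrix_mult_distribs algebra_simps)
        then show ?thesis
          using finite_zeros_det_affine by (simp only:)
      qed
      let ?x0 = "\<lambda>i\<in>{..<m}. A $ r i $ c i"
      show "?x0 \<in> ?V" by simp
      have "P ?x0 = A"
        by (rule P(4)[OF A(1)]) simp
      then show "?g ?x0 \<noteq> 0"
        using A(2) by simp
    qed simp
    \<comment> \<open>In the completion every subset of a null set is null, so inclusion of the
      chart image suffices below.\<close>
    then have "{x \<in> ?V. ?g x = 0} \<in> null_sets (completion (Pi\<^sub>M {..<m} (\<lambda>_. lborel)))"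
      by (rule null_sets_completionI)
    moreover have "\<phi> K ` (?bad \<inter> U K) \<subseteq> {x \<in> ?V. ?g x = 0}"
    proof (intro image_subsetI CollectI conjI)
      fix \<Theta> assume \<Theta>: "\<Theta> \<in> ?bad \<inter> U K"
      then show "\<phi> K \<Theta> \<in> ?V"
        using chart(2) by blast
      have "?D ** cayley (P (\<phi> K \<Theta>)) = \<Theta>"
        using chart(2) \<Theta> by blast
      then have "det (mat 1 + ?D ** cayley (P (\<phi> K \<Theta>))) = 0"
        using \<Theta> by simp
      then show "?g (\<phi> K \<Theta>) = 0"
        by (simp only: det_one_plus_mult_cayley[OF det_one_plus_skew[OF P(1)]])
    qed
    ultimately show "\<phi> K ` (?bad \<inter> U K) \<in> null_sets (completion (Pi\<^sub>M {..<m} (\<lambda>_. lborel)))"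
      by (rule null_sets_completion_subset[rotated])
  qed
  moreover have "\<Theta> \<in> (\<Union>(U, \<phi>)\<in>?C. U)" if "\<Theta> \<in> ?bad" for \<Theta>
  proof -
    from that have "\<Theta> \<in> SO" by simp
    then obtain K where "det (sign_matrix K + \<Theta>) \<noteq> 0"
      "sign_matrix K \<in> (SO :: (real^'n^'n) set)" "even (card K)"
      by (rule exists_sign_matrix_in_SO)
    then show ?thesis
      using that by (intro UN_I[of "(U K, \<phi> K)"]) (auto simp: U_def)
  qed
  ultimately show ?thesis
    unfolding manifold_measure_zero_def m_def[symmetric]
    by (intro exI[of _ ?C] conjI subsetI) auto
qed

text \<open>In a chart around \<open>\<Theta>\<close>, the segment towards a skew matrix with
  nonzero determinant polynomial meets the zero set finitely often, so good points accumulate at its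
  start.\<close>

lemma SO_subset_closure_det_one_plus_nonzero:
  fixes \<Theta> :: "real^'n^'n"
  assumes \<Theta>: "\<Theta> \<in> SO"
  shows "\<Theta> \<in> closure {\<Theta> \<in> SO. det (mat 1 + \<Theta>) \<noteq> 0}"
proof -
  obtain K where K: "det (sign_matrix K + \<Theta>) \<noteq> 0" "sign_matrix K \<in> (SO :: (real^'n^'n) set)" "even (card K)"
    by (rule exists_sign_matrix_in_SO[OF \<Theta>])
  let ?D = "sign_matrix K :: real^'n^'n"
  have "det (mat 1 + ?D ** \<Theta>) = det ?D * det (?D + \<Theta>)"
    by (simp add: matrix_mult_distribs sign_matrix_square flip: det_mul)
  then have det: "det (mat 1 + ?D ** \<Theta>) \<noteq> 0"
    using K by (simp add: SO_def rotation_matrix_def)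
  obtain B where B: "skew_symmetric B" "det ((mat 1 + ?D) + (mat 1 - ?D) ** B) \<noteq> 0"
    using exists_skew_det_nonzero[OF K(3)] by blast
  define A where "A = cayley (?D ** \<Theta>)"
  have A: "skew_symmetric A"
    unfolding A_def by (intro skew_symmetric_cayley SO_mult K \<Theta> det)
  define \<gamma> where "\<gamma> t = A + t *\<^sub>R (B - A)" for t :: real
  have skew: "skew_symmetric (\<gamma> t)" for t
    unfolding \<gamma>_def by (intro skew_symmetric_add skew_symmetric_scaleR skew_symmetric_diff A B)
  let ?q = "\<lambda>t. det ((mat 1 + ?D) + (mat 1 - ?D) ** \<gamma> t)"
  have "(mat 1 + ?D) + (mat 1 - ?D) ** \<gamma> t
      = ((mat 1 + ?D) + (mat 1 - ?D) ** A) + t *\<^sub>R ((mat 1 - ?D) ** (B - A))" for t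
    by (simp add: \<gamma>_def matrix_mult_distribs)
  then have "finite {t. ?q t = 0} \<or> (\<forall>t. ?q t = 0)"
    using finite_zeros_det_affine by (simp only:)
  moreover have "?q 1 \<noteq> 0"
    using B(2) by (simp add: \<gamma>_def)
  ultimately have fin: "finite {t. ?q t = 0}"
    by blast
  \<comment> \<open>The parameter 0 is taken out of the zero set because \<open>\<Theta>\<close>
    itself may be a bad point.\<close>
  have "open (- ({t. ?q t = 0} - {0}))"
    using fin by (intro open_Compl finite_imp_closed) simp
  then have "\<forall>\<^sub>F t in at 0. t \<in> - ({t. ?q t = 0} - {0})"
    by (rule eventually_at_in_open') simp
  then have "\<forall>\<^sub>F t in at 0. ?q t \<noteq> 0"
    using eventually_neq_at_within[of 0] by eventually_elim auto
  then have ev: "\<forall>\<^sub>F t in at 0. ?D ** cayley (\<gamma> t) \<in> closure {\<Theta> \<in> SO. det (mat 1 + \<Theta>) \<noteq> 0}"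
  proof eventually_elim
    case (elim t)
    then have "det (mat 1 + ?D ** cayley (\<gamma> t)) \<noteq> 0"
      by (simp only: det_one_plus_mult_cayley[OF det_one_plus_skew[OF skew]] not_False_eq_True)
    moreover have "?D ** cayley (\<gamma> t) \<in> SO"
      by (intro SO_mult K cayley_skew_in_SO skew)
    ultimately show ?case
      by (intro subsetD[OF closure_subset]) simp
  qed
  have "(\<gamma> \<longlongrightarrow> A + 0 *\<^sub>R (B - A)) (at 0)"
    unfolding \<gamma>_def[abs_def] by (intro tendsto_intros)
  then have "((\<lambda>t. cayley (\<gamma> t)) \<longlongrightarrow> cayley A) (at 0)"
    by (intro isCont_tendsto_compose[OF isCont_cayley[OF det_one_plus_skew[OF A]]]) simp
  then have "((\<lambda>t. ?D ** cayley (\<gamma> t)) \<longlongrightarrow> ?D ** cayley A) (at 0)"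
    by (intro matrix_mult_tendsto tendsto_const)
  also have "?D ** cayley A = \<Theta>"
    by (simp add: A_def cayley_cayley[OF det] matrix_mul_assoc sign_matrix_square)
  finally show ?thesis
    by (intro Lim_in_closed_set[OF closed_closure ev]) simp_all
qed

section \<open>Stability and basins of attraction\<close>

lemma flow_solution_cong:
  assumes "\<And>p. p \<in> M \<Longrightarrow> X p = Y p"
  shows "flow_solution M X = flow_solution M Y"
  unfolding flow_solution_def fun_eq_iff using assms by auto

lemma trace_flow_solution_from:
  fixes \<Theta> :: "real^'n^'n"
  assumes "\<Theta> \<in> SO" "det (mat 1 + \<Theta>) \<noteq> 0"
  obtains \<theta> where "flow_solution SO trace_flow \<theta>" "\<theta> 0 = \<Theta>" "(\<theta> \<longlongrightarrow> mat 1) at_top"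
proof
  show "flow_solution SO trace_flow (\<lambda>t. cayley (exp (- t) *\<^sub>R cayley \<Theta>))"
    by (intro flow_solution_cayley skew_symmetric_cayley assms)
  show "cayley (exp (- 0) *\<^sub>R cayley \<Theta>) = \<Theta>"
    by (simp add: cayley_cayley[OF assms(2)])
  show "((\<lambda>t. cayley (exp (- t) *\<^sub>R cayley \<Theta>)) \<longlongrightarrow> mat 1) at_top"
    by (rule cayley_flow_tendsto)
qed

text \<open>Arbitrarily close to \<open>\<Theta>\<close> start solutions tending to
  \<open>mat 1\<close>; none of them can remain within half the distance between the two
  points.\<close>

lemma trace_flow_unstable:
  fixes \<Theta> :: "real^'n^'n"
  assumes "\<Theta> \<in> SO" "\<Theta> \<noteq> mat 1"
  shows "\<not> lyapunov_stable SO trace_flow \<Theta>"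
proof
  let ?\<epsilon> = "dist (mat 1) \<Theta> / 2"
  assume "lyapunov_stable SO trace_flow \<Theta>"
  moreover have "?\<epsilon> > 0"
    using assms(2) by simp
  ultimately obtain \<delta> where "\<delta> > 0"
    and \<delta>: "\<And>\<theta>. flow_solution SO trace_flow \<theta> \<Longrightarrow> dist (\<theta> 0) \<Theta> < \<delta> \<Longrightarrow> \<forall>t\<ge>0. dist (\<theta> t) \<Theta> < ?\<epsilon>"
    unfolding lyapunov_stable_def by metis
  obtain x where x: "x \<in> SO" "det (mat 1 + x) \<noteq> 0" "dist x \<Theta> < \<delta>"
    using SO_subset_closure_det_one_plus_nonzero[OF assms(1)] \<open>\<delta> > 0\<close> unfolding closure_approachable by blast
  obtain \<theta> where \<theta>: "flow_solution SO trace_flow \<theta>" "\<theta> 0 = x" "(\<theta> \<longlongrightarrow> mat 1) at_top"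
    by (rule trace_flow_solution_from[OF x(1,2)])
  have "\<forall>\<^sub>F t in at_top. dist (\<theta> t) \<Theta> \<le> ?\<epsilon>"
    using \<delta>[OF \<theta>(1)] x \<theta>(2) by (intro eventually_at_top_linorderI[of 0]) (simp add: less_imp_le)
  then have "dist (mat 1) \<Theta> \<le> ?\<epsilon>"
    by (intro tendsto_upperbound[OF tendsto_dist[OF \<theta>(3) tendsto_const]]) simp_all
  then show False
    using \<open>?\<epsilon> > 0\<close> by simp
qed

lemma manifold_measure_zero_subset:
  fixes M :: "'a::euclidean_space set"
  assumes "manifold_measure_zero M m A" "B \<subseteq> A"
  shows "manifold_measure_zero M m B"
proof -
  from assms(1) obtain \<C> where
    C: "\<forall>(U, \<phi>)\<in>\<C>. smooth_chart M m U \<phi> \<and>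
      \<phi> ` (A \<inter> U) \<in> null_sets (completion (Pi\<^sub>M {..<m} (\<lambda>_. lborel)))"
    and cover: "A \<subseteq> (\<Union>(U, \<phi>)\<in>\<C>. U)"
    unfolding manifold_measure_zero_def by (elim exE conjE) (rule that)
  show ?thesis
    unfolding manifold_measure_zero_def
  proof (intro exI[of _ \<C>] conjI ballI)
    fix c assume "c \<in> \<C>"
    obtain U \<phi> where c: "c = (U, \<phi>)"
      by (rule prod.exhaust)
    have "smooth_chart M m U \<phi>"
      and "\<phi> ` (A \<inter> U) \<in> null_sets (completion (Pi\<^sub>M {..<m} (\<lambda>_. lborel)))"
      using bspec[OF C \<open>c \<in> \<C>\<close>] by (simp_all add: c)
    moreover have "\<phi> ` (B \<inter> U) \<subseteq> \<phi> ` (A \<inter> U)"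
      using assms(2) by blast
    ultimately show "case c of (U, \<phi>) \<Rightarrow> smooth_chart M m U \<phi> \<and>
        \<phi> ` (B \<inter> U) \<in> null_sets (completion (Pi\<^sub>M {..<m} (\<lambda>_. lborel)))"
      using null_sets_completion_subset by (simp add: c)
  next
    show "B \<subseteq> (\<Union>(U, \<phi>)\<in>\<C>. U)"
      using cover assms(2) by (rule order_trans[rotated])
  qed
qed

theorem lemma7:
  fixes f :: "real^'n^'n \<Rightarrow> real"
    and X :: "real^'n^'n \<Rightarrow> real^'n^'n"
    and F :: "(real^'n^'n) set"
  assumes f: "\<And>\<Theta>. \<Theta> \<in> SO \<Longrightarrow> f \<Theta> = real CARD('n) - trace \<Theta>"
    and X: "\<And>\<Theta>. X \<Theta> = - SO_grad f \<Theta>"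
    and F: "F = {\<Theta>\<^sub>0 \<in> SO. transpose \<Theta>\<^sub>0 = \<Theta>\<^sub>0}"
  shows "(equilibria SO X = F \<and>
          (\<forall>\<theta>. flow_solution SO X \<theta> \<longrightarrow> omega_limit_set \<theta> \<subseteq> F)) \<and>
         (locally_exponentially_stable SO X (mat 1) \<and>
          (\<forall>\<Theta>\<^sub>0\<in>F - {mat 1}. \<not> lyapunov_stable SO X \<Theta>\<^sub>0)) \<and>
         (SO \<subseteq> closure (converging_initial_conditions SO X {mat 1}) \<and>
          manifold_measure_zero SO (CARD('n) * (CARD('n) - 1) div 2)
            (converging_initial_conditions SO X (F - {mat 1})))"
proof -
  \<comment> \<open>The gradient is identified only on \<open>SO\<close>; solutions stay there, so
    both fields have the same solutions.\<close>
  have X_eq: "X \<Theta> = trace_flow \<Theta>" if "\<Theta> \<in> SO" for \<Theta>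
  proof -
    have "SO_grad f \<Theta> = (1/2) *\<^sub>R (\<Theta> ** \<Theta> - mat 1)"
      by (rule SO_grad_eq) (use f that in auto)
    then show ?thesis
      by (simp add: X trace_flow_def scaleR_right_diff_distrib)
  qed
  have flow: "flow_solution SO X = flow_solution SO trace_flow"
    by (rule flow_solution_cong[OF X_eq])
  have "equilibria SO X = F"
    by (auto simp: equilibria_def F X_eq trace_flow_eq_0_iff)
  moreover have "omega_limit_set \<theta> \<subseteq> F" if "flow_solution SO X \<theta>" for \<theta>
    using trace_flow_omega_limit[of \<theta>] that by (auto simp: flow F)
  moreover have "locally_exponentially_stable SO X (mat 1)"
    using trace_flow_exponentially_stable by (simp only: locally_exponentially_stable_def flow)
  moreover have "\<not> lyapunov_stable SO X \<Theta>\<^sub>0" if "\<Theta>\<^sub>0 \<in> F - {mat 1}" for \<Theta>\<^sub>0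
  proof -
    have "\<not> lyapunov_stable SO trace_flow \<Theta>\<^sub>0"
      using that by (intro trace_flow_unstable) (auto simp: F)
    then show ?thesis
      by (simp only: lyapunov_stable_def flow not_False_eq_True)
  qed
  moreover have "SO \<subseteq> closure (converging_initial_conditions SO X {mat 1})"
  proof -
    have "{\<Theta> \<in> SO. det (mat 1 + \<Theta> :: real^'n^'n) \<noteq> 0} \<subseteq> converging_initial_conditions SO X {mat 1}"
    proof (intro subsetI, elim CollectE conjE)
      fix \<Theta> :: "real^'n^'n" assume \<Theta>: "\<Theta> \<in> SO" "det (mat 1 + \<Theta>) \<noteq> 0"
      obtain \<theta> where "flow_solution SO trace_flow \<theta>" "\<theta> 0 = \<Theta>" "(\<theta> \<longlongrightarrow> mat 1) at_top"
        by (rule trace_flow_solution_from[OF \<Theta>])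
      then show "\<Theta> \<in> converging_initial_conditions SO X {mat 1}"
        using \<Theta> by (auto simp: converging_initial_conditions_def flow)
    qed
    then show ?thesis
      using SO_subset_closure_det_one_plus_nonzero closure_mono by blast
  qed
  moreover have "manifold_measure_zero SO (CARD('n) * (CARD('n) - 1) div 2)
      (converging_initial_conditions SO X (F - {mat 1}))"
  proof (rule manifold_measure_zero_subset[OF det_one_plus_zero_measure_zero], rule subsetI)
    fix \<Theta> assume "\<Theta> \<in> converging_initial_conditions SO X (F - {mat 1})"
    then obtain \<theta> p where "\<Theta> \<in> SO" and \<theta>: "flow_solution SO trace_flow \<theta>" "\<theta> 0 = \<Theta>"
      and p: "p \<noteq> mat 1" "(\<theta> \<longlongrightarrow> p) at_top"
      by (auto simp: converging_initial_conditions_def flow)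
    have "det (mat 1 + \<Theta>) = 0"
    proof (rule ccontr)
      assume "det (mat 1 + \<Theta>) \<noteq> 0"
      then have "(\<theta> \<longlongrightarrow> mat 1) at_top"
        using trace_flow_converges[OF \<theta>(1)] \<theta>(2) by simp
      then show False
        using tendsto_unique[OF _ p(2)] p(1) by simp
    qed
    then show "\<Theta> \<in> {\<Theta> \<in> SO. det (mat 1 + \<Theta>) = 0}"
      using \<open>\<Theta> \<in> SO\<close> by simp
  qed
  ultimately show ?thesis by blast
qed

end
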